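(* Let $K\in\mathbb{C}^{n\times n}$ be a marginal kernel matrix which is an orthogonal projection of rank $k$ (i.e. $K=K^H=K^2$, $\operatorname{rank}K=k$). Performing $k$ steps of diagonally-pivoted Cholesky factorization of $K$, where each pivot index is chosen by sampling from the diagonal as in the algorithm $\mathcal{B}$ described in the context (in exact arithmetic), is equivalent to sampling from $\mathrm{DPP}(K)$; that is, the random set returned by $\mathcal{B}$ has distribution $\mathrm{DPP}(K)$. This approach has complexity $O(nk^2)$, and it almost surely completes and returns a sample of cardinality $k$. The likelihood of the resulting sample is the square of the product of the first $k$ diagonal entries of the partially factored matrix $A$ at termination, i.e. $\left(\prod_{j=0}^{k-1}A_{j,j}\right)^2$.
   Context: Notation: $[n]=\{0,1,\dots,n-1\}$, and $[j:k]=\{j,j+1,\dots,k-1\}$. For an $n\times n$ matrix $A$ and $Y,Z\subseteq[n]$, $A_{Y,Z}$ is the submatrix with row indices in $Y$ and column indices in $Z$, and $A_Y=A_{Y,Y}$. The determinant of the empty matrix is $1$. A finite determinantal point process (DPP) with marginal kernel matrix $K\in\mathbb{C}^{n\times n}$ is a random subset $\mathbf{Y}$ of $[n]$ such that $\mathbb{P}[Y\subseteq\mathbf{Y}]=\det(K_Y)$ for every $Y\subseteq[n]$; its distribution is denoted $\mathrm{DPP}(K)$. The likelihood of a sample $Y$ is $\mathbb{P}[\mathbf{Y}=Y]$. Algorithm $\mathcal{B}$ (unblocked, left-looking, diagonally-pivoted Cholesky-based sampling). Initialize $A:=K$, the vector $d:=\operatorname{diag}(K)$, and the list $o:=(0,1,\dots,n-1)$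 of original indices. For $j=0,1,\dots,k-1$ in order: (i) Draw an index $t\in[j:n]$ with probability $d_t/(k-j)$ (with fresh randomness given the past). (ii) Perform a Hermitian swap of indices $j$ and $t$ of $A$ (swap rows $j,t$ and columns $j,t$, where only the lower triangle of $A$ is meaningful and the strictly upper part of the unfactored trailing block is understood through Hermiticity), and swap positions $j$ and $t$ in $o$ and in $d$. (iii) Set $A_{j,j}:=\sqrt{d_j}$. If $j=k-1$, stop the loop. (iv) Replace $A_{[j+1:n],\{j\}}$ by $A_{[j+1:n],\{j\}}-A_{[j+1:n],[0:j]}\,(A_{\{j\},[0:j]})^H$. (v) For each $t\in[j+1:n]$: replace $A_{t,j}$ by $A_{t,j}/A_{j,j}$, and then replace $d_t$ by $d_t-|A_{t,j}|^2$. Return the set of the first $k$ entries of $o$ as the sample, together with $A_{[0:k]}$. Complexity counts arithmetic operations of the factorization performed in place on the preformed matrix $K$ (the cost of forming or copying $K$ is not counted). *)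

theory Defs
  imports
    "HOL-Probability.SPMF"
    "Jordan_Normal_Form.Schur_Decomposition"
    "Jordan_Normal_Form.DL_Rank"
    "Jordan_Normal_Form.DL_Submatrix"
begin

section \<open>Determinantal point processes\<close>

definition is_DPP :: "nat \<Rightarrow> complex mat \<Rightarrow> nat set pmf \<Rightarrow> bool" where
  "is_DPP n K p \<longleftrightarrow>
     set_pmf p \<subseteq> Pow {0..<n} \<and>
     (\<forall>Y \<subseteq> {0..<n}. complex_of_real (measure_pmf.prob p {S. Y \<subseteq> S}) = det (submatrix K Y Y))"

definition marginal_kernel :: "nat \<Rightarrow> complex mat \<Rightarrow> bool" where
  "marginal_kernel n K \<longleftrightarrow> K \<in> carrier_mat n n \<and> (\<exists>p. is_DPP n K p)"

section \<open>Randomized programs with operation counting\<close>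

text \<open>
  A program is a subdistribution over pairs of a result and the number of scalar operations spent
  on that run. The missing mass is the probability that the run breaks down (division by zero,
  square root of a negative number, or a draw from weights that are not a probability vector).
  Every scalar operation, real or complex, has unit cost.
\<close>

datatype 'a prog = Prog (run: "('a \<times> nat) spmf")

definition ret :: "'a \<Rightarrow> 'a prog" where
  "ret x = Prog (return_spmf (x, 0))"

definition fail :: "'a prog" where
  "fail = Prog (return_pmf None)"

definition bind_prog :: "'a prog \<Rightarrow> ('a \<Rightarrow> 'b prog) \<Rightarrow> 'b prog" where
  "bind_prog m f =
     Prog (bind_spmf (run m) (\<lambda>(x, c). map_spmf (\<lambda>(y, c'). (y, c + c')) (run (f x))))"

adhoc_overloading Monad_Syntax.bind \<rightleftharpoons> bind_prog

text \<open>One scalar operation with the given value.\<close>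

definition tick :: "'a \<Rightarrow> 'a prog" where
  "tick x = Prog (return_spmf (x, 1))"

definition divide_prog :: "complex \<Rightarrow> complex \<Rightarrow> complex prog" where
  "divide_prog x y = (if y = 0 then fail else tick (x / y))"

definition sqrt_prog :: "real \<Rightarrow> real prog" where
  "sqrt_prog x = (if x < 0 then fail else tick (sqrt x))"

primrec for_each :: "nat list \<Rightarrow> (nat \<Rightarrow> 's \<Rightarrow> 's prog) \<Rightarrow> 's \<Rightarrow> 's prog" where
  "for_each [] f s = ret s"
| "for_each (x # xs) f s = do { s' \<leftarrow> f x s; for_each xs f s' }"

text \<open>
  Per outcome, two operations are charged:
  the division that forms its weight and an addition for the cumulative sums.
\<close>

definition draw :: "(nat \<times> real) list \<Rightarrow> nat prog" where
  "draw ws =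
     (if pmf_of_list_wf ws
      then Prog (map_spmf (\<lambda>t. (t, 2 * length ws)) (spmf_of_pmf (pmf_of_list ws)))
      else fail)"

section \<open>The sampling algorithm\<close>

definition swap_list :: "'a list \<Rightarrow> nat \<Rightarrow> nat \<Rightarrow> 'a list" where
  "swap_list xs i j = xs[i := xs ! j, j := xs ! i]"

text \<open>Only the lower triangle of the working matrix is ever read; entries above it are obtained
  through Hermiticity.\<close>

definition herm_entry :: "complex mat \<Rightarrow> nat \<Rightarrow> nat \<Rightarrow> complex" where
  "herm_entry A i l = (if l \<le> i then A $$ (i, l) else cnj (A $$ (l, i)))"

text \<open>Data movement only, hence free of cost. When \<open>j \<le> t\<close>, the swap moves an entry of a column
  before \<open>j\<close> within that column, so \<open>herm_entry\<close> conjugates only inside the trailing block that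
  starts at \<open>(j, j)\<close>.\<close>

definition herm_swap :: "nat \<Rightarrow> nat \<Rightarrow> complex mat \<Rightarrow> complex mat" where
  "herm_swap j t A = mat (dim_row A) (dim_col A) (\<lambda>(i, l).
     if l \<le> i then herm_entry A (Transposition.transpose j t i) (Transposition.transpose j t l)
     else A $$ (i, l))"

definition update_column :: "nat \<Rightarrow> nat \<Rightarrow> complex mat \<Rightarrow> complex mat prog" where
  "update_column n j =
     for_each [j+1..<n] (\<lambda>i.
       for_each [0..<j] (\<lambda>l A. do {
         c \<leftarrow> tick (cnj (A $$ (j, l)));
         p \<leftarrow> tick (A $$ (i, l) * c);
         x \<leftarrow> tick (A $$ (i, j) - p);
         ret (A |\<^sub>m (i, j) \<mapsto> x) }))"

definition scale_column ::
    "nat \<Rightarrow> nat \<Rightarrow> complex mat \<times> real list \<Rightarrow> (complex mat \<times> real list) prog" where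
  "scale_column n j =
     for_each [j+1..<n] (\<lambda>t (A, d). do {
       x \<leftarrow> divide_prog (A $$ (t, j)) (A $$ (j, j));
       s \<leftarrow> tick ((cmod x)\<^sup>2);
       y \<leftarrow> tick (d ! t - s);
       ret (A |\<^sub>m (t, j) \<mapsto> x, d[t := y]) })"

type_synonym chol_state = "complex mat \<times> real list \<times> nat list"

definition chol_step :: "nat \<Rightarrow> nat \<Rightarrow> nat \<Rightarrow> chol_state \<Rightarrow> chol_state prog" where
  "chol_step n k j = (\<lambda>(A, d, os). do {
     t \<leftarrow> draw (map (\<lambda>t. (t, d ! t / real (k - j))) [j..<n]);
     let A = herm_swap j t A;
     let d = swap_list d j t;
     let os = swap_list os j t;
     r \<leftarrow> sqrt_prog (d ! j);
     let A = (A |\<^sub>m (j, j) \<mapsto> complex_of_real r);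
     if j = k - 1 then ret (A, d, os)
     else do {
       A \<leftarrow> update_column n j A;
       (A, d) \<leftarrow> scale_column n j (A, d);
       ret (A, d, os) } })"

text \<open>The diagonal of a Hermitian matrix is real, so \<open>d\<close> is kept as a list of reals.\<close>

definition cholesky_sampler :: "nat \<Rightarrow> nat \<Rightarrow> complex mat \<Rightarrow> (nat set \<times> complex mat) prog" where
  "cholesky_sampler n k K = do {
     (A, d, os) \<leftarrow> for_each [0..<k] (chol_step n k) (K, map Re (diag_mat K), [0..<n]);
     ret (set (take k os), submatrix A {0..<k} {0..<k}) }"

end

theory Submission
  imports Defs "Jordan_Normal_Form.DL_Rank_Submatrix"
begin

text \<open>
  A principal minor of a Hermitian projection \<open>P\<close> with a nonzero entry \<open>P x x\<close> factors as
  \<open>det P_Z = P x x * det S_(Z - {x})\<close>, where the Schur complement \<open>S\<close> of \<open>P\<close> at \<open>x\<close> is again a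
  projection, of trace one less (\<open>minor_Cons\<close>, \<open>hproj_schur\<close>, \<open>hproj_schur_trace\<close>). The trace of a
  projection is its rank (\<open>hproj_rank_eq_trace\<close>), so after \<open>j\<close> pivots the diagonal of the residual is
  nonnegative with sum \<open>k - j\<close>. Divided by \<open>k - j\<close> it is therefore a probability vector, every
  pivot drawn from it is positive, and no run breaks down.

  The algorithm carries exactly this data: the vector \<open>d\<close> is the diagonal of the residual, and the
  column computed in step \<open>j\<close> is a column of the residual divided by the square root of the pivot
  (\<open>chol_inv\<close>, \<open>ensures_pivot_step\<close>). The operation counts are carried along in the same triples;
  each step costs at most \<open>6 n k\<close>.

  If \<open>x\<close> is the first pivot, which has probability \<open>P x x / k\<close>, then by induction the remaining
  steps yield \<open>Y - {x}\<close> with probability \<open>det S_(Y - {x})\<close>. Each of the \<open>k\<close> elements \<open>x\<close> of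
  \<open>Y\<close> thus contributes \<open>det P_Y / k\<close>, so that \<open>Y\<close> is sampled with probability \<open>det P_Y\<close>
  (\<open>spmf_pivot_set\<close>). A determinantal point process with kernel \<open>P\<close> gives the same probability to each
  set of \<open>k\<close> elements, because all minors of size above the rank vanish (\<open>DPP_pmf\<close>). These
  probabilities sum to one, since the algorithm does not fail, so the two laws agree
  (\<open>pmf_eqI_le\<close>). The likelihood formula follows because the minor of the sampled set is the product
  of the pivots (\<open>minor_eq_prod_pivots\<close>), whose square roots form the diagonal of the factor.
\<close>

section \<open>Principal minors and Schur complements\<close>

text \<open>
  The Schur complement of the entry \<open>(x, x)\<close>. Matrices are entry functions here, and pivoting keeps
  the index set: if \<open>P x x \<noteq> 0\<close>, row and column \<open>x\<close> become zero instead of being deleted. Hence the swaps of the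
  algorithm never have to be tracked in the linear algebra.
\<close>

definition schur :: "(nat \<Rightarrow> nat \<Rightarrow> complex) \<Rightarrow> nat \<Rightarrow> nat \<Rightarrow> nat \<Rightarrow> complex" where
  "schur P x a b = P a b - P a x * P x b / P x x"

text \<open>
  The principal minor of \<open>P\<close> with rows and columns listed in the order of \<open>xs\<close>.
\<close>

definition minor :: "(nat \<Rightarrow> nat \<Rightarrow> complex) \<Rightarrow> nat list \<Rightarrow> complex" where
  "minor P xs = det (mat (length xs) (length xs) (\<lambda>(a, b). P (xs ! a) (xs ! b)))"

lemma minor_permute:
  assumes "mset xs = mset ys"
  shows "minor P xs = minor P ys"
proof -
  define m where "m = length ys"
  obtain p where p: "p permutes {..<m}" and xs: "permute_list p ys = xs"
    using assms mset_eq_permutation unfolding m_def by metis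
  have p': "p permutes {0..<m}" using p by (simp add: lessThan_atLeast0)
  have len: "length xs = m" using xs by (auto simp: m_def)
  have nth: "xs ! i = ys ! p i" if "i < m" for i
    using that permute_list_nth[of p ys i] p xs by (auto simp: m_def)
  have pm: "p i < m" if "i < m" for i using permutes_in_image[OF p, of i] that by simp
  define M where "M = mat m m (\<lambda>(a, b). P (ys ! a) (ys ! b))"
  define M1 where "M1 = mat m m (\<lambda>(i, j). M $$ (p i, j))"
  have M: "M \<in> carrier_mat m m" and M1: "M1 \<in> carrier_mat m m" by (auto simp: M_def M1_def)
  have eq: "transpose_mat (mat m m (\<lambda>(a, b). P (xs ! a) (xs ! b)))
      = mat m m (\<lambda>(i, j). transpose_mat M1 $$ (p i, j))"
    by (rule eq_matI) (auto simp: M1_def M_def nth pm)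
  have "minor P xs = det (transpose_mat (mat m m (\<lambda>(a, b). P (xs ! a) (xs ! b))))"
    unfolding minor_def len by (rule det_transpose[symmetric, of _ m]) simp
  also have "\<dots> = signof p * det (transpose_mat M1)"
    unfolding eq by (rule det_permute_rows[OF _ p']) (simp add: M1)
  also have "\<dots> = signof p * (signof p * det M)"
    using det_permute_rows[OF M p'] det_transpose[OF M1] by (simp add: M1_def)
  also have "\<dots> = det M" by (simp add: sign_def)
  finally show ?thesis by (simp add: M_def minor_def m_def)
qed

text \<open>
  The determinant identity of Schur, from the block factorization
  \<open>[p, B; C p, C B + D] = [1, 0; C, 1] * [p, B; 0, D]\<close> with the pivot \<open>p = P x x\<close>.
\<close>

lemma minor_Cons:
  assumes "P x x \<noteq> 0"
  shows "minor P (x # xs) = P x x * minor (schur P x) xs"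
proof -
  define m where "m = length xs"
  define A where "A = mat 1 1 (\<lambda>_. P x x)"
  define B where "B = mat 1 m (\<lambda>(a, b). P x (xs ! b))"
  define C where "C = mat m 1 (\<lambda>(a, b). P (xs ! a) x / P x x)"
  define D where "D = mat m m (\<lambda>(a, b). schur P x (xs ! a) (xs ! b))"
  have cA: "A \<in> carrier_mat 1 1" and cB: "B \<in> carrier_mat 1 m" and cC: "C \<in> carrier_mat m 1"
    and cD: "D \<in> carrier_mat m m"
    by (auto simp: A_def B_def C_def D_def)
  let ?L = "four_block_mat (1\<^sub>m 1) (0\<^sub>m 1 m) C (1\<^sub>m m)"
  let ?U = "four_block_mat A B (0\<^sub>m m 1) D"
  have "mat (Suc m) (Suc m) (\<lambda>(a, b). P ((x # xs) ! a) ((x # xs) ! b))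
      = four_block_mat A B (C * A) (C * B + D)"
    using assms
    by (intro eq_matI)
      (auto simp: A_def B_def C_def D_def schur_def scalar_prod_def nth_Cons' less_Suc_eq_0_disj)
  also have "\<dots> = ?L * ?U"
    by (subst mult_four_block_mat[OF _ _ cC _ cA cB _ cD]) (use cA cB cC cD in auto)
  finally have "minor P (x # xs) = det (?L * ?U)" by (simp add: minor_def m_def)
  also have "\<dots> = det ?L * det ?U"
    by (rule det_mult[of _ "1 + m"]) (use cA cB cC cD in auto)
  also have "det ?L = 1"
    by (subst det_four_block_mat_upper_right_zero[OF _ refl cC]) auto
  also have "det ?U = det A * det D"
    by (rule det_four_block_mat_lower_left_zero[OF cA cB refl cD])
  also have "det A = P x x" by (simp add: A_def det_single)
  finally show ?thesis by (simp add: D_def minor_def m_def)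
qed

lemma minor_zero_row:
  assumes "x \<in> set xs" "\<And>b. b \<in> set xs \<Longrightarrow> P x b = 0"
  shows "minor P xs = 0"
proof -
  obtain i where i: "i < length xs" "xs ! i = x" using assms(1) by (auto simp: in_set_conv_nth)
  have "(\<Prod>a = 0..<length xs. mat (length xs) (length xs) (\<lambda>(a, b). P (xs ! a) (xs ! b)) $$ (a, p a)) = 0"
    if "p permutes {0..<length xs}" for p
  proof (rule prod_zero)
    have "p i < length xs" using permutes_in_image[OF that, of i] i by auto
    then show "\<exists>a\<in>{0..<length xs}.
        mat (length xs) (length xs) (\<lambda>(a, b). P (xs ! a) (xs ! b)) $$ (a, p a) = 0"
      using i assms(2) by (intro bexI[of _ i]) auto
  qed simp
  then show ?thesis unfolding minor_def det_def by (auto intro!: sum.neutral)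
qed

lemma det_submatrix_eq_minor:
  assumes "K \<in> carrier_mat n n" "set xs \<subseteq> {0..<n}" "distinct xs"
  shows "det (submatrix K (set xs) (set xs)) = minor (\<lambda>a b. K $$ (a, b)) xs"
proof -
  define Y where "Y = set xs"
  define ys where "ys = map (pick Y) [0..<card Y]"
  have Yn: "{i. i < n \<and> i \<in> Y} = Y" using assms(2) by (auto simp: Y_def)
  have inj: "inj_on (pick Y) {0..<card Y}"
  proof (rule inj_onI)
    fix a b assume "a \<in> {0..<card Y}" "b \<in> {0..<card Y}" "pick Y a = pick Y b"
    then show "a = b"
      using pick_mono_le[of b Y a] pick_mono_le[of a Y b] by (cases a b rule: linorder_cases) auto
  qed
  then have "distinct ys" by (simp add: ys_def distinct_map)
  have "pick Y ` {0..<card Y} = Y"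
    by (rule card_subset_eq) (auto simp: Y_def card_image[OF inj[unfolded Y_def]] intro!: pick_in_set_le)
  then have "set ys = Y" by (simp add: ys_def)
  have "mset xs = mset ys"
    using \<open>distinct ys\<close> \<open>set ys = Y\<close> assms(3) set_eq_iff_mset_eq_distinct[of xs ys] by (simp add: Y_def)
  moreover have "submatrix K Y Y = mat (length ys) (length ys) (\<lambda>(a, b). K $$ (ys ! a, ys ! b))"
    using assms(1) by (intro eq_matI) (auto simp: dim_submatrix Yn ys_def submatrix_index)
  ultimately show ?thesis
    using minor_permute[of xs ys "\<lambda>a b. K $$ (a, b)"] by (simp add: minor_def Y_def)
qed

section \<open>Orthogonal projections\<close>

text \<open>
  \<open>P\<close> is the entry function of an orthogonal projection (Hermitian and idempotent) of size \<open>n\<close>;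
  its values at indices outside \<open>{0..<n}\<close> do not matter.
\<close>

definition hproj :: "nat \<Rightarrow> (nat \<Rightarrow> nat \<Rightarrow> complex) \<Rightarrow> bool" where
  "hproj n P \<longleftrightarrow> (\<forall>a<n. \<forall>b<n. P b a = cnj (P a b)) \<and> (\<forall>a<n. \<forall>b<n. (\<Sum>c<n. P a c * P c b) = P a b)"

lemma hprojD:
  assumes "hproj n P" "a < n" "b < n"
  shows "P b a = cnj (P a b)" "(\<Sum>c<n. P a c * P c b) = P a b"
  using assms unfolding hproj_def by blast+

lemma hproj_diag:
  assumes "hproj n P" "a < n"
  shows "P a a = complex_of_real (\<Sum>c<n. (cmod (P a c))\<^sup>2)"
proof -
  have "P a a = (\<Sum>c<n. P a c * P c a)" using hprojD(2)[OF assms(1,2,2)] by simp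
  also have "\<dots> = (\<Sum>c<n. complex_of_real ((cmod (P a c))\<^sup>2))"
  proof (rule sum.cong[OF refl])
    fix c assume "c \<in> {..<n}"
    then have "P c a = cnj (P a c)" using hprojD(1)[OF assms(1,2), of c] by simp
    then show "P a c * P c a = complex_of_real ((cmod (P a c))\<^sup>2)"
      by (simp only: complex_norm_square)
  qed
  finally show ?thesis by simp
qed

lemma hproj_diag_Re:
  assumes "hproj n P" "a < n"
  shows "P a a = complex_of_real (Re (P a a))" "0 \<le> Re (P a a)"
proof -
  have e: "Re (P a a) = (\<Sum>c<n. (cmod (P a c))\<^sup>2)"
    using arg_cong[OF hproj_diag[OF assms], of Re] by simp
  show "P a a = complex_of_real (Re (P a a))" unfolding e by (rule hproj_diag[OF assms])
  show "0 \<le> Re (P a a)" unfolding e by (simp add: sum_nonneg)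
qed

text \<open>
  A projection with \<open>P a a = 0\<close> has zero row \<open>a\<close>, as \<open>P a a\<close> is the squared norm of that row.
\<close>

lemma hproj_zero_row:
  assumes "hproj n P" "a < n" "P a a = 0" "b < n"
  shows "P a b = 0"
proof -
  have "(\<Sum>c<n. (cmod (P a c))\<^sup>2) = 0"
    using hproj_diag[OF assms(1,2)] assms(3) by (metis of_real_eq_0_iff)
  then show ?thesis using assms(4) by (auto simp: sum_nonneg_eq_0_iff)
qed

text \<open>
  Pivoting subtracts from a projection the rank-one projection onto the line spanned by its column
  \<open>x\<close>, so what remains is again a projection, and the trace drops by exactly one.
\<close>

lemma hproj_schur:
  assumes P: "hproj n P" and x: "x < n" and nz: "P x x \<noteq> 0"
  shows "hproj n (schur P x)"
  unfolding hproj_def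
proof (intro conjI allI impI)
  fix a b assume a: "a < n" and b: "b < n"
  have "cnj (P x x) = P x x" by (rule hprojD(1)[OF P x x, symmetric])
  then show "schur P x b a = cnj (schur P x a b)"
    by (simp add: schur_def hprojD(1)[OF P a b] hprojD(1)[OF P b x] hprojD(1)[OF P x a] mult.commute)
  have e: "schur P x a c * schur P x c b = P a c * P c b - P a c * P c x * (P x b / P x x)
        - (P a x / P x x) * (P x c * P c b) + (P a x / P x x) * (P x b / P x x) * (P x c * P c x)" for c
    using nz by (simp add: schur_def field_simps)
  have "(\<Sum>c<n. schur P x a c * schur P x c b)
      = P a b - P a x * (P x b / P x x) - (P a x / P x x) * P x b + (P a x / P x x) * (P x b / P x x) * P x x"
    unfolding e sum.distrib sum_subtractf sum_distrib_left[symmetric] sum_distrib_right[symmetric]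
    by (simp add: hprojD(2)[OF P] a b x)
  also have "\<dots> = schur P x a b" using nz by (simp add: schur_def field_simps)
  finally show "(\<Sum>c<n. schur P x a c * schur P x c b) = schur P x a b" .
qed

lemma hproj_schur_trace:
  assumes P: "hproj n P" and x: "x < n" and nz: "P x x \<noteq> 0"
  shows "(\<Sum>a<n. schur P x a a) = (\<Sum>a<n. P a a) - 1"
proof -
  have "(\<Sum>a<n. schur P x a a) = (\<Sum>a<n. P a a) - (\<Sum>a<n. P x a * P a x) / P x x"
    by (simp add: schur_def sum_subtractf sum_divide_distrib mult.commute)
  then show ?thesis using nz by (simp add: hprojD(2)[OF P x x])
qed

lemma schur_zero_row: "P a x = 0 \<Longrightarrow> P a b = 0 \<Longrightarrow> schur P x a b = 0"
  by (simp add: schur_def)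

lemma schur_pivot_row: "P x x \<noteq> 0 \<Longrightarrow> schur P x x b = 0"
  by (simp add: schur_def)

text \<open>
  Splitting off rank-one terms until nothing is left writes \<open>P\<close> as a sum of as many rank-one
  matrices as its trace says; the number of nonzero diagonal entries decreases in each step.
\<close>

lemma hproj_rank_le_trace:
  assumes "hproj n P"
  shows "real (vec_space.rank n (mat n n (\<lambda>(a, b). P a b))) \<le> (\<Sum>a<n. Re (P a a))"
  using assms
proof (induction "card {a. a < n \<and> P a a \<noteq> 0}" arbitrary: P rule: less_induct)
  case less
  show ?case
  proof (cases "\<exists>x<n. P x x \<noteq> 0")
    case False
    then have "mat n n (\<lambda>(a, b). P a b) = 0\<^sub>m n n"
      using hproj_zero_row[OF less.prems] by (intro eq_matI) auto
    then show ?thesis using False by (simp add: vec_space.rank_0I)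
  next
    case True
    then obtain x where x: "x < n" and nz: "P x x \<noteq> 0" by blast
    let ?S = "schur P x"
    have S: "hproj n ?S" by (rule hproj_schur[OF less.prems x nz])
    have "?S a a = 0" if "a < n" "P a a = 0" for a
      using hproj_zero_row[OF less.prems that] that x by (simp add: schur_def)
    moreover have "?S x x = 0"
      using nz by (rule schur_pivot_row)
    ultimately have "{a. a < n \<and> ?S a a \<noteq> 0} \<subset> {a. a < n \<and> P a a \<noteq> 0}"
      using x nz by blast
    then have "card {a. a < n \<and> ?S a a \<noteq> 0} < card {a. a < n \<and> P a a \<noteq> 0}"
      by (intro psubset_card_mono) auto
    note IH = less.hyps[of ?S, OF this S]
    let ?R = "mat n n (\<lambda>(a, b). P a x * (P x b / P x x))"
    have "mat n n (\<lambda>(a, b). P a b) = mat n n (\<lambda>(a, b). ?S a b) + ?R"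
      by (intro eq_matI) (auto simp: schur_def)
    then have "vec_space.rank n (mat n n (\<lambda>(a, b). P a b))
        \<le> vec_space.rank n (mat n n (\<lambda>(a, b). ?S a b)) + vec_space.rank n ?R"
      using vec_space.rank_subadditive[of "mat n n (\<lambda>(a, b). ?S a b)" n n ?R] by simp
    also have "\<dots> \<le> vec_space.rank n (mat n n (\<lambda>(a, b). ?S a b)) + 1"
      by (intro add_left_mono vec_space.rank_le_1_product_entries[of _ n n "\<lambda>a. P a x" "\<lambda>b. P x b / P x x"]) auto
    finally have "real (vec_space.rank n (mat n n (\<lambda>(a, b). P a b)))
        \<le> real (vec_space.rank n (mat n n (\<lambda>(a, b). ?S a b))) + 1"
      by simp
    also have "\<dots> \<le> (\<Sum>a<n. Re (?S a a)) + 1"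
      using IH by simp
    also have "\<dots> = (\<Sum>a<n. Re (P a a))"
      using arg_cong[OF hproj_schur_trace[OF less.prems x nz], of Re]
      by (simp only: Re_sum minus_complex.sel one_complex.sel)
    finally show ?thesis .
  qed
qed

text \<open>
  The inequality for \<open>P\<close> and for the complementary projection \<open>I - P\<close>, together with
  \<open>n = rank I \<le> rank P + rank (I - P)\<close>, forces equality.
\<close>

lemma hproj_rank_eq_trace:
  assumes P: "hproj n P"
  shows "(\<Sum>a<n. Re (P a a)) = real (vec_space.rank n (mat n n (\<lambda>(a, b). P a b)))"
proof -
  \<comment> \<open>the complementary projection \<open>I - P\<close>\<close>
  define Q where "Q = (\<lambda>a b. (if a = b then 1 else 0) - P a b)"
  have Q: "hproj n Q" unfolding hproj_def
  proof (intro conjI allI impI)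
    fix a b assume a: "a < n" and b: "b < n"
    show "Q b a = cnj (Q a b)" by (simp add: Q_def hprojD(1)[OF P a b])
    have "Q a c * Q c b = (if c = b then Q a b else 0) - (if c = a then P a b else 0) + P a c * P c b" for c
      by (auto simp: Q_def algebra_simps)
    then show "(\<Sum>c<n. Q a c * Q c b) = Q a b"
      using a b by (simp add: sum.distrib sum_subtractf hprojD(2)[OF P a b])
  qed
  have "(1\<^sub>m n :: complex mat) = mat n n (\<lambda>(a, b). P a b) + mat n n (\<lambda>(a, b). Q a b)"
    by (intro eq_matI) (auto simp: Q_def)
  then have "vec_space.rank n (1\<^sub>m n :: complex mat)
      \<le> vec_space.rank n (mat n n (\<lambda>(a, b). P a b)) + vec_space.rank n (mat n n (\<lambda>(a, b). Q a b))"
    using vec_space.rank_subadditive[of "mat n n (\<lambda>(a, b). P a b)" n n "mat n n (\<lambda>(a, b). Q a b)"] by simp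
  moreover have "vec_space.rank n (1\<^sub>m n :: complex mat) = n"
    using vec_space.det_rank_iff[of "1\<^sub>m n :: complex mat" n] by simp
  moreover have "(\<Sum>a<n. Re (Q a a)) = real n - (\<Sum>a<n. Re (P a a))"
    by (simp add: Q_def sum_subtractf)
  ultimately show ?thesis
    using hproj_rank_le_trace[OF P] hproj_rank_le_trace[OF Q] by linarith
qed

section \<open>Reasoning about randomized programs with costs\<close>

text \<open>
  A total-correctness triple for randomized programs: no run breaks down, every run costs at most
  \<open>c\<close>, and every possible result satisfies \<open>Q\<close>.
\<close>

definition ensures :: "'a prog \<Rightarrow> nat \<Rightarrow> ('a \<Rightarrow> bool) \<Rightarrow> bool" where
  "ensures m c Q \<longleftrightarrow> lossless_spmf (run m) \<and> (\<forall>(x, c') \<in> set_spmf (run m). c' \<le> c \<and> Q x)"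

lemma ensures_weaken:
  "ensures m c Q \<Longrightarrow> c \<le> c' \<Longrightarrow> (\<And>x. Q x \<Longrightarrow> Q' x) \<Longrightarrow> ensures m c' Q'"
  unfolding ensures_def by (auto split: prod.splits)

lemma ensures_ret: "Q x \<Longrightarrow> ensures (ret x) 0 Q"
  by (simp add: ensures_def ret_def)

lemma ensures_tick: "ensures (tick x) 1 (\<lambda>y. y = x)"
  by (simp add: ensures_def tick_def)

lemma ensures_divide: "y \<noteq> 0 \<Longrightarrow> ensures (divide_prog x y) 1 (\<lambda>z. z = x / y)"
  using ensures_tick[of "x / y"] by (simp add: divide_prog_def)

lemma ensures_sqrt: "0 \<le> x \<Longrightarrow> ensures (sqrt_prog x) 1 (\<lambda>z. z = sqrt x)"
  using ensures_tick[of "sqrt x"] by (simp add: sqrt_prog_def)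

lemma ensures_draw:
  "pmf_of_list_wf ws \<Longrightarrow> ensures (draw ws) (2 * length ws) (\<lambda>t. t \<in> set_pmf (pmf_of_list ws))"
  by (auto simp: ensures_def draw_def)

lemma ensures_bind:
  assumes "ensures m c R" "\<And>x. R x \<Longrightarrow> ensures (f x) c' Q"
  shows "ensures (bind_prog m f) (c + c') Q"
  unfolding ensures_def
proof (intro conjI ballI)
  have f: "lossless_spmf (run (f x))" "\<And>y d. (y, d) \<in> set_spmf (run (f x)) \<Longrightarrow> d \<le> c' \<and> Q y"
      and c: "d \<le> c"
    if "(x, d) \<in> set_spmf (run m)" for x d
    using assms that unfolding ensures_def by blast+
  show "lossless_spmf (run (bind_prog m f))"
    using assms(1) f(1) by (auto simp: bind_prog_def ensures_def)
  fix z assume "z \<in> set_spmf (run (bind_prog m f))"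
  then obtain x d y e where "(x, d) \<in> set_spmf (run m)" "(y, e) \<in> set_spmf (run (f x))" "z = (y, d + e)"
    by (auto simp: bind_prog_def set_bind_spmf)
  then show "case z of (y, c'') \<Rightarrow> c'' \<le> c + c' \<and> Q y"
    using f(2) c by (auto intro: add_mono)
qed

lemma ensures_for_each:
  assumes "a \<le> b" "I a s"
    and "\<And>i s. a \<le> i \<Longrightarrow> i < b \<Longrightarrow> I i s \<Longrightarrow> ensures (f i s) c (I (Suc i))"
  shows "ensures (for_each [a..<b] f s) ((b - a) * c) (I b)"
  using assms
proof (induction "b - a" arbitrary: a s)
  case 0
  then show ?case by (auto intro!: ensures_ret)
next
  case (Suc m)
  then have "[a..<b] = a # [Suc a..<b]"
    by (simp add: upt_conv_Cons)
  moreover have "b - a = Suc (b - Suc a)"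
    using Suc.hyps(2) by simp
  moreover have "ensures (bind_prog (f a s) (for_each [Suc a..<b] f)) (c + (b - Suc a) * c) (I b)"
    using Suc.hyps(2) Suc.prems by (intro ensures_bind[where R = "I (Suc a)"] Suc.hyps(1)) auto
  ultimately show ?case by simp
qed

text \<open>
  The law of the result of a program, without the cost.
\<close>

definition outcome :: "'a prog \<Rightarrow> 'a spmf" where
  "outcome m = map_spmf fst (run m)"

lemma outcome_bind: "outcome (bind_prog m f) = bind_spmf (outcome m) (\<lambda>x. outcome (f x))"
  by (auto simp: outcome_def bind_prog_def map_spmf_bind_spmf bind_map_spmf spmf.map_comp o_def case_prod_beta
      intro!: bind_spmf_cong)

lemma outcome_draw: "pmf_of_list_wf ws \<Longrightarrow> outcome (draw ws) = spmf_of_pmf (pmf_of_list ws)"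
  by (simp add: outcome_def draw_def pmf.map_comp o_def)

lemma outcome_ret: "outcome (ret x) = return_spmf x"
  by (simp add: outcome_def ret_def)

lemma spmf_bind_const:
  assumes "lossless_spmf p" "\<And>x. x \<in> set_spmf p \<Longrightarrow> spmf (f x) y = q"
  shows "spmf (bind_spmf p f) y = q"
proof -
  have "spmf (bind_spmf p f) y = (\<integral>x. q \<partial>measure_spmf p)"
    unfolding spmf_bind by (rule integral_cong_AE) (use assms(2) in auto)
  then show ?thesis
    using lossless_weight_spmfD[OF assms(1)] by (simp add: weight_spmf_def space_measure_spmf)
qed

text \<open>
  A program that cannot break down may be skipped when the law of what follows is the same for all
  its possible results. This disposes of the arithmetic that follows a draw.
\<close>

lemma spmf_outcome_bind_const:
  assumes "ensures m c R" "\<And>x. R x \<Longrightarrow> spmf (map_spmf g (outcome (f x))) y = q"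
  shows "spmf (map_spmf g (outcome (bind_prog m f))) y = q"
  unfolding outcome_bind map_spmf_bind_spmf
  by (rule spmf_bind_const) (use assms in \<open>auto simp: ensures_def outcome_def\<close>)

section \<open>The loops that update a column\<close>

text \<open>
  The inner loop changes the single entry \<open>(i, j)\<close> and the outer loop only column \<open>j\<close>, so that all
  entries read by the updates still have their initial values.
\<close>

lemma ensures_update_column:
  assumes A: "A \<in> carrier_mat n n" and "j < n"
  shows "ensures (update_column n j A) ((n - (j + 1)) * (j * 3))
    (\<lambda>A'. A' = mat n n (\<lambda>(i, l). if l = j \<and> j < i
       then A $$ (i, j) - (\<Sum>m<j. A $$ (i, m) * cnj (A $$ (j, m))) else A $$ (i, l)))"
proof -
  define v where "v i m = A $$ (i, j) - (\<Sum>m'<m. A $$ (i, m') * cnj (A $$ (j, m')))" for i m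
  define I where "I b B \<longleftrightarrow> B = mat n n (\<lambda>(i, l). if l = j \<and> j < i \<and> i < b then v i j else A $$ (i, l))"
    for b B
  have "ensures (update_column n j A) ((n - (j + 1)) * (j * 3)) (I n)"
    unfolding update_column_def
  proof (rule ensures_for_each)
    show "j + 1 \<le> n" using assms by simp
    show "I (j + 1) A" unfolding I_def using A by (intro eq_matI) auto
    fix i B assume i: "j + 1 \<le> i" "i < n" and B: "I i B"
    define J where "J m B' \<longleftrightarrow> B' = (B |\<^sub>m (i, j) \<mapsto> v i m)" for m B'
    have Bdim: "dim_row B = n" "dim_col B = n" using B by (auto simp: I_def)
    have "ensures (for_each [0..<j] (\<lambda>l A. do {
         c \<leftarrow> tick (cnj (A $$ (j, l)));
         p \<leftarrow> tick (A $$ (i, l) * c);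
         x \<leftarrow> tick (A $$ (i, j) - p);
         ret (A |\<^sub>m (i, j) \<mapsto> x) }) B) ((j - 0) * 3) (J j)"
    proof (rule ensures_for_each)
      show "J 0 B"
        unfolding J_def using Bdim B i by (intro eq_matI) (auto simp: I_def update_mat_def v_def)
      fix l B' assume l: "l < j" and B': "J l B'"
      have "B' $$ (j, l) = A $$ (j, l)" "B' $$ (i, l) = A $$ (i, l)" "B' $$ (i, j) = v i l"
        using B' B i l by (auto simp: J_def I_def update_mat_def)
      moreover have "(B' |\<^sub>m (i, j) \<mapsto> x) = (B |\<^sub>m (i, j) \<mapsto> x)" for x
        using B' Bdim by (intro eq_matI) (auto simp: J_def update_mat_def)
      ultimately have post: "J (Suc l) (B' |\<^sub>m (i, j) \<mapsto> B' $$ (i, j) - B' $$ (i, l) * cnj (B' $$ (j, l)))"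
        by (simp add: J_def v_def diff_diff_add)
      show "ensures (do {
         c \<leftarrow> tick (cnj (B' $$ (j, l)));
         p \<leftarrow> tick (B' $$ (i, l) * c);
         x \<leftarrow> tick (B' $$ (i, j) - p);
         ret (B' |\<^sub>m (i, j) \<mapsto> x) }) 3 (J (Suc l))"
        by (rule ensures_weaken[where c = "1 + (1 + (1 + 0))" and Q = "J (Suc l)"],
          intro ensures_bind[OF ensures_tick] ensures_ret, simp_all add: post)
    qed simp
    moreover have "I (Suc i) B'" if "J j B'" for B'
      using that B Bdim i unfolding J_def I_def by (intro eq_matI) (auto simp: update_mat_def less_Suc_eq)
    ultimately show "ensures (for_each [0..<j] (\<lambda>l A. do {
         c \<leftarrow> tick (cnj (A $$ (j, l)));
         p \<leftarrow> tick (A $$ (i, l) * c);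
         x \<leftarrow> tick (A $$ (i, j) - p);
         ret (A |\<^sub>m (i, j) \<mapsto> x) }) B) (j * 3) (I (Suc i))"
      by (elim ensures_weaken) auto
  qed
  then show ?thesis
    by (rule ensures_weaken) (auto simp: I_def v_def intro!: eq_matI)
qed

lemma ensures_scale_column:
  assumes A: "A \<in> carrier_mat n n" and "j < n" and d: "length d = n" and nz: "A $$ (j, j) \<noteq> 0"
  shows "ensures (scale_column n j (A, d)) ((n - (j + 1)) * 3)
    (\<lambda>s. s = (mat n n (\<lambda>(i, l). if l = j \<and> j < i then A $$ (i, j) / A $$ (j, j) else A $$ (i, l)),
       map (\<lambda>i. if j < i then d ! i - (cmod (A $$ (i, j) / A $$ (j, j)))\<^sup>2 else d ! i) [0..<n]))"
proof -
  define x where "x i = A $$ (i, j) / A $$ (j, j)" for i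
  define B where "B b = mat n n (\<lambda>(i, l). if l = j \<and> j < i \<and> i < b then x i else A $$ (i, l))" for b
  define e where "e b = map (\<lambda>i. if j < i \<and> i < b then d ! i - (cmod (x i))\<^sup>2 else d ! i) [0..<n]" for b
  have "ensures (scale_column n j (A, d)) ((n - (j + 1)) * 3) (\<lambda>s. s = (B n, e n))"
    unfolding scale_column_def
  proof (rule ensures_for_each)
    show "j + 1 \<le> n" using assms by simp
    show "(A, d) = (B (j + 1), e (j + 1))"
      using A d by (auto simp: B_def e_def intro!: eq_matI nth_equalityI)
    fix i and s :: "complex mat \<times> real list"
    assume i: "j + 1 \<le> i" "i < n" and s: "s = (B i, e i)"
    have entries: "B i $$ (i, j) / B i $$ (j, j) = x i" "B i $$ (j, j) \<noteq> 0" "e i ! i = d ! i"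
      using i nz by (auto simp: B_def e_def x_def)
    have B_step: "(B i |\<^sub>m (i, j) \<mapsto> x i) = B (Suc i)"
      using i by (intro eq_matI) (auto simp: B_def update_mat_def)
    have e_step: "(e i)[i := d ! i - (cmod (x i))\<^sup>2] = e (Suc i)"
      using i by (intro nth_equalityI) (auto simp: e_def nth_list_update)
    show "ensures (case s of (A, d) \<Rightarrow> do {
       x \<leftarrow> divide_prog (A $$ (i, j)) (A $$ (j, j));
       s \<leftarrow> tick ((cmod x)\<^sup>2);
       y \<leftarrow> tick (d ! i - s);
       ret (A |\<^sub>m (i, j) \<mapsto> x, d[i := y]) }) 3 (\<lambda>s. s = (B (Suc i), e (Suc i)))"
      unfolding s prod.case
      by (rule ensures_weaken[where c = "1 + (1 + (1 + 0))" and Q = "\<lambda>s. s = (B (Suc i), e (Suc i))"],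
        intro ensures_bind[OF ensures_tick] ensures_bind[OF ensures_divide] ensures_ret,
        simp_all add: entries B_step e_step)
  qed
  then show ?thesis
    by (rule ensures_weaken) (auto simp: B_def e_def x_def intro!: eq_matI)
qed

section \<open>Residuals along a sequence of pivots\<close>

text \<open>
  The matrix that remains after pivoting on the indices \<open>xs\<close>, first to last.
\<close>

definition residual :: "(nat \<Rightarrow> nat \<Rightarrow> complex) \<Rightarrow> nat list \<Rightarrow> nat \<Rightarrow> nat \<Rightarrow> complex" where
  "residual P xs = foldl schur P xs"

text \<open>
  The diagonal entry on which step \<open>l\<close> pivots when the pivot indices are chosen in the order of \<open>xs\<close>.
\<close>

definition pivot :: "(nat \<Rightarrow> nat \<Rightarrow> complex) \<Rightarrow> nat list \<Rightarrow> nat \<Rightarrow> complex" where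
  "pivot P xs l = residual P (take l xs) (xs ! l) (xs ! l)"

lemma residual_Nil [simp]: "residual P [] = P"
  and residual_Cons: "residual P (x # xs) = residual (schur P x) xs"
  and residual_snoc: "residual P (xs @ [x]) = schur (residual P xs) x"
  by (simp_all add: residual_def)

lemma residual_take_Suc:
  "l < length xs \<Longrightarrow> residual P (take (Suc l) xs) = schur (residual P (take l xs)) (xs ! l)"
  by (simp add: take_Suc_conv_app_nth residual_snoc)

lemma pivot_take: "l < m \<Longrightarrow> m \<le> length xs \<Longrightarrow> pivot P (take m xs) l = pivot P xs l"
  by (simp add: pivot_def min_def)

lemma residual_hproj:
  assumes "hproj n P" "set xs \<subseteq> {0..<n}" "\<And>l. l < length xs \<Longrightarrow> pivot P xs l \<noteq> 0"
  shows "hproj n (residual P xs)"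
    and "(\<Sum>a<n. residual P xs a a) = (\<Sum>a<n. P a a) - of_nat (length xs)"
    and "x \<in> set xs \<Longrightarrow> b < n \<Longrightarrow> residual P xs x b = 0"
proof -
  have "hproj n (residual P xs) \<and>
    (\<Sum>a<n. residual P xs a a) = (\<Sum>a<n. P a a) - of_nat (length xs) \<and>
    (\<forall>x\<in>set xs. \<forall>b<n. residual P xs x b = 0)"
    using assms(2,3)
  proof (induction xs rule: rev_induct)
    case Nil
    then show ?case using assms(1) by simp
  next
    case (snoc x xs)
    have "pivot P xs l \<noteq> 0" if "l < length xs" for l
      using snoc.prems(2)[of l] that by (simp add: pivot_def nth_append)
    then have IH: "hproj n (residual P xs)"
      "(\<Sum>a<n. residual P xs a a) = (\<Sum>a<n. P a a) - of_nat (length xs)"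
      "\<forall>x\<in>set xs. \<forall>b<n. residual P xs x b = 0"
      using snoc.IH snoc.prems(1) by auto
    have nz: "residual P xs x x \<noteq> 0"
      using snoc.prems(2)[of "length xs"] by (simp add: pivot_def)
    have x: "x < n" using snoc.prems(1) by auto
    show ?case
      unfolding residual_snoc
      using hproj_schur[OF IH(1) x nz] hproj_schur_trace[OF IH(1) x nz] IH(2,3) x
      by (auto simp: schur_zero_row schur_pivot_row[of "residual P xs", OF nz])
  qed
  then show "hproj n (residual P xs)"
    and "(\<Sum>a<n. residual P xs a a) = (\<Sum>a<n. P a a) - of_nat (length xs)"
    and "x \<in> set xs \<Longrightarrow> b < n \<Longrightarrow> residual P xs x b = 0"
    by blast+
qed

text \<open>
  The left-looking form of the residual: the algorithm computes a column of it from the original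
  matrix and the columns already factored.
\<close>

lemma residual_expand:
  assumes "j \<le> length xs"
  shows "residual P (take j xs) a b =
    P a b - (\<Sum>l<j. residual P (take l xs) a (xs ! l) * residual P (take l xs) (xs ! l) b / pivot P xs l)"
  using assms
proof (induction j)
  case (Suc j)
  then show ?case by (simp add: residual_take_Suc schur_def pivot_def)
qed simp

lemma minor_eq_prod_pivots:
  assumes "\<And>l. l < length xs \<Longrightarrow> pivot P xs l \<noteq> 0"
  shows "minor P xs = (\<Prod>l<length xs. pivot P xs l)"
  using assms
proof (induction xs arbitrary: P)
  case Nil
  then show ?case by (simp add: minor_def)
next
  case (Cons x xs)
  have Suc: "pivot P (x # xs) (Suc l) = pivot (schur P x) xs l" for l
    by (simp add: pivot_def residual_Cons)
  have "pivot (schur P x) xs l \<noteq> 0" if "l < length xs" for l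
    using Cons.prems[of "Suc l"] that by (simp add: Suc)
  then have "minor (schur P x) xs = (\<Prod>l<length xs. pivot (schur P x) xs l)"
    by (rule Cons.IH)
  moreover have "pivot P (x # xs) 0 = P x x" by (simp add: pivot_def)
  moreover have "P x x \<noteq> 0" using Cons.prems[of 0] by (simp add: pivot_def)
  ultimately show ?case
    by (simp add: minor_Cons prod.lessThan_Suc_shift Suc del: prod.lessThan_Suc)
qed

lemma schur_diag:
  assumes P: "hproj n P" and "a < n" "x < n" and nz: "P x x \<noteq> 0"
  shows "Re (schur P x a a) = Re (P a a) - (cmod (P a x / complex_of_real (sqrt (Re (P x x)))))\<^sup>2"
proof -
  have "P a x * P x a = complex_of_real ((cmod (P a x))\<^sup>2)"
    by (simp only: hprojD(1)[OF P assms(2,3)] complex_norm_square)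
  moreover have "P x x = complex_of_real (Re (P x x))" and "0 \<le> Re (P x x)"
    using hproj_diag_Re[OF P assms(3)] by auto
  ultimately have "Re (P a x * P x a / P x x) = (cmod (P a x))\<^sup>2 / Re (P x x)"
    by (metis Re_complex_of_real of_real_divide)
  then show ?thesis
    using \<open>0 \<le> Re (P x x)\<close> by (simp add: schur_def norm_divide power_divide)
qed

section \<open>One pivoted Cholesky step\<close>

text \<open>
  The state before step \<open>j\<close>, expressed through the residuals along the pivots \<open>os ! 0, \<dots>, os ! (j - 1)\<close>:
  the columns before \<open>j\<close> hold the Cholesky factor, the lower triangle from column \<open>j\<close> on still holds
  the permuted input, and \<open>d\<close> holds the diagonal of the residual. The last step neither updates its
  column nor \<open>d\<close>, so for \<open>j = k\<close> only the pivots and the diagonal of the factor are described.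
\<close>

definition chol_inv ::
    "nat \<Rightarrow> nat \<Rightarrow> (nat \<Rightarrow> nat \<Rightarrow> complex) \<Rightarrow> nat \<Rightarrow> chol_state \<Rightarrow> bool" where
  "chol_inv n k P j = (\<lambda>(A, d, os).
     A \<in> carrier_mat n n \<and> length d = n \<and> distinct os \<and> set os = {0..<n} \<and>
     (\<forall>l<j. pivot P os l \<noteq> 0 \<and> A $$ (l, l) = complex_of_real (sqrt (Re (pivot P os l)))) \<and>
     (j < k \<longrightarrow>
       (\<forall>l<j. \<forall>i<n. l < i \<longrightarrow> A $$ (i, l) =
          residual P (take l os) (os ! i) (os ! l) / complex_of_real (sqrt (Re (pivot P os l)))) \<and>
       (\<forall>i<n. \<forall>l\<le>i. j \<le> l \<longrightarrow> A $$ (i, l) = P (os ! i) (os ! l)) \<and>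
       (\<forall>i<n. j \<le> i \<longrightarrow> d ! i = Re (residual P (take j os) (os ! i) (os ! i)))))"

lemma chol_inv_length:
  assumes "chol_inv n k P j (A, d, os)"
  shows "length os = n"
  using assms distinct_card[of os] by (auto simp: chol_inv_def)

lemma chol_inv_residual:
  assumes P: "hproj n P" and inv: "chol_inv n k P j (A, d, os)" and "l \<le> j" "j \<le> n"
  shows "hproj n (residual P (take l os))"
    and "(\<Sum>a<n. residual P (take l os) a a) = (\<Sum>a<n. P a a) - of_nat l"
    and "x \<in> set (take l os) \<Longrightarrow> b < n \<Longrightarrow> residual P (take l os) x b = 0"
proof -
  have "length os = n" by (rule chol_inv_length[OF inv])
  then have len: "length (take l os) = l" using assms by simp
  have sub: "set (take l os) \<subseteq> {0..<n}"
    using inv set_take_subset[of l os] by (auto simp: chol_inv_def)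
  have piv: "pivot P (take l os) m \<noteq> 0" if "m < length (take l os)" for m
    using that inv assms(3,4) len \<open>length os = n\<close> by (simp add: pivot_take chol_inv_def)
  show "hproj n (residual P (take l os))"
    and "(\<Sum>a<n. residual P (take l os) a a) = (\<Sum>a<n. P a a) - of_nat l"
    and "x \<in> set (take l os) \<Longrightarrow> b < n \<Longrightarrow> residual P (take l os) x b = 0"
    using residual_hproj[OF P sub piv] len by simp_all
qed

text \<open>
  A step of the algorithm after its draw, as a function of the drawn position \<open>t\<close>.
\<close>

definition pivot_step :: "nat \<Rightarrow> nat \<Rightarrow> nat \<Rightarrow> chol_state \<Rightarrow> nat \<Rightarrow> chol_state prog" where
  "pivot_step n k j = (\<lambda>(A, d, os) t. do {
     let A = herm_swap j t A;
     let d = swap_list d j t;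
     let os = swap_list os j t;
     r \<leftarrow> sqrt_prog (d ! j);
     let A = (A |\<^sub>m (j, j) \<mapsto> complex_of_real r);
     if j = k - 1 then ret (A, d, os)
     else do {
       A \<leftarrow> update_column n j A;
       (A, d) \<leftarrow> scale_column n j (A, d);
       ret (A, d, os) } })"

text \<open>
  The weighted list from which step \<open>j\<close> draws its position.
\<close>

definition weights :: "nat \<Rightarrow> nat \<Rightarrow> nat \<Rightarrow> real list \<Rightarrow> (nat \<times> real) list" where
  "weights n k j d = map (\<lambda>t. (t, d ! t / real (k - j))) [j..<n]"

lemma chol_step_eq:
  "chol_step n k j (A, d, os) = bind_prog (draw (weights n k j d)) (pivot_step n k j (A, d, os))"
  by (simp add: chol_step_def pivot_step_def weights_def)

lemma nth_swap_list:
  "i < length xs \<Longrightarrow> j < length xs \<Longrightarrow> t < length xs \<Longrightarrow>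
   swap_list xs j t ! i = xs ! Transposition.transpose j t i"
  by (auto simp: swap_list_def nth_list_update Transposition.transpose_def)

lemma take_swap_list: "l \<le> j \<Longrightarrow> j \<le> t \<Longrightarrow> take l (swap_list xs j t) = take l xs"
  by (simp add: swap_list_def)

lemma mset_swap_list:
  "j < length xs \<Longrightarrow> t < length xs \<Longrightarrow> mset (swap_list xs j t) = mset xs"
  using mset_swap[of t xs j] by (simp add: swap_list_def)

text \<open>
  The correctness of one step. The index \<open>os ! t\<close> becomes the next pivot; since \<open>d ! t \<noteq> 0\<close> it is a
  positive diagonal entry of the residual, so neither the square root nor the divisions break down.
\<close>

lemma ensures_pivot_step:
  assumes P: "hproj n P" and inv: "chol_inv n k P j (A, d, os)"
    and jk: "j < k" and jt: "j \<le> t" and tn: "t < n" and dt: "d ! t \<noteq> 0"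
  shows "ensures (pivot_step n k j (A, d, os) t) (1 + 3 * n * k)
    (\<lambda>(A', d', os'). chol_inv n k P (Suc j) (A', d', os') \<and> take (Suc j) os' = take j os @ [os ! t])"
proof -
  have jn: "j < n" using jt tn by simp
  \<comment> \<open>Position \<open>i\<close> receives the data of position \<open>\<tau> i\<close>; primes denote the lists after the swap.\<close>
  define \<tau> where "\<tau> = Transposition.transpose j t"
  define os' where "os' = swap_list os j t"
  define d' where "d' = swap_list d j t"
  define R where "R l = residual P (take l os')" for l
  define x where "x = os' ! j"
  define r where "r = sqrt (d' ! j)"
  define A1 where "A1 = (herm_swap j t A |\<^sub>m (j, j) \<mapsto> complex_of_real r)"
  have len: "length os = n" "length d = n" "A \<in> carrier_mat n n"
    using chol_inv_length[OF inv] inv by (auto simp: chol_inv_def)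
  have \<tau>n: "\<tau> i < n" if "i < n" for i
    using that jn tn by (auto simp: \<tau>_def Transposition.transpose_def)
  have \<tau>j: "j \<le> \<tau> i" if "j \<le> i" for i
    using that jt by (auto simp: \<tau>_def Transposition.transpose_def)
  have \<tau>l: "\<tau> l = l" if "l < j" for l
    using that jt by (auto simp: \<tau>_def Transposition.transpose_def)
  have os'_nth: "os' ! i = os ! \<tau> i" if "i < n" for i
    using that jn tn len by (simp add: os'_def \<tau>_def nth_swap_list)
  have d'_nth: "d' ! i = d ! \<tau> i" if "i < n" for i
    using that jn tn len by (simp add: d'_def \<tau>_def nth_swap_list)
  have "mset os' = mset os" using jn tn len by (simp add: os'_def mset_swap_list)
  then have os'_perm: "distinct os'" "set os' = {0..<n}" "length os' = n"
    using inv len mset_eq_setD[of os' os] mset_eq_imp_distinct_iff[of os' os] mset_eq_length[of os' os]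
    by (auto simp: chol_inv_def)
  have os'_less: "os' ! i < n" if "i < n" for i
    using that os'_perm nth_mem[of i os'] by auto
  have take: "take l os' = take l os" if "l \<le> j" for l
    using that jt by (simp add: os'_def take_swap_list)
  have R: "hproj n (R l)" if "l \<le> j" for l
    using chol_inv_residual(1)[OF P inv that] jn by (simp add: R_def take[OF that])
  have pivot_R: "pivot P os' l = R l (os' ! l) (os' ! l)" for l
    by (simp add: pivot_def R_def)
  have pivot_old: "pivot P os' l = pivot P os l" if "l < j" for l
    using that os'_nth[of l] \<tau>l jn by (simp add: pivot_def take)
  have x: "x < n" "x = os ! t" using os'_less[OF jn] os'_nth[OF jn] by (auto simp: x_def \<tau>_def)
  have d'_R: "d' ! i = Re (R j (os' ! i) (os' ! i))" if "j \<le> i" "i < n" for i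
    using inv jk d'_nth[OF that(2)] os'_nth[OF that(2)] \<tau>j[OF that(1)] \<tau>n[OF that(2)]
    by (simp add: chol_inv_def R_def take)
  have d'j: "d' ! j = Re (R j x x)" using d'_R[of j] jn by (simp add: x_def)
  have "d' ! j = d ! t" using d'_nth[OF jn] by (simp add: \<tau>_def)
  then have nz: "R j x x \<noteq> 0" using dt d'j by auto
  have pos: "0 < Re (R j x x)"
    using hproj_diag_Re[OF R[OF order_refl] x(1)] dt d'j \<open>d' ! j = d ! t\<close> by auto
  have r: "r = sqrt (Re (R j x x))" "r \<noteq> 0" "0 \<le> d' ! j" using pos d'j by (auto simp: r_def)
  have piv: "pivot P os' l \<noteq> 0" "Re (pivot P os' l) > 0"
    "complex_of_real (Re (pivot P os' l)) = pivot P os' l" if "l \<le> j" for l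
  proof -
    show "pivot P os' l \<noteq> 0"
      using nz inv that pivot_R[of j] pivot_old[of l] by (cases "l = j") (auto simp: x_def chol_inv_def)
    moreover have "os' ! l < n" using that jn by (simp add: os'_less)
    note hproj_diag_Re[OF R[OF that] this]
    ultimately show "Re (pivot P os' l) > 0" "complex_of_real (Re (pivot P os' l)) = pivot P os' l"
      by (auto simp: pivot_R less_le)
  qed
  \<comment> \<open>The entries of the working matrix after the swap and the square root.\<close>
  have A1: "A1 \<in> carrier_mat n n" using len by (intro carrier_matI) (auto simp: A1_def herm_swap_def)
  have swap: "herm_swap j t A $$ (i, l) = herm_entry A (\<tau> i) (\<tau> l)" if "i < n" "l \<le> i" for i l
    using that len by (simp add: herm_swap_def \<tau>_def)
  have A1_jj: "A1 $$ (j, j) = complex_of_real r"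
    using len jn by (simp add: A1_def herm_swap_def)
  have A1_done: "A1 $$ (i, l) = R l (os' ! i) (os' ! l) / complex_of_real (sqrt (Re (pivot P os' l)))"
    if "l < j" "l < i" "i < n" for i l
  proof -
    have "l < \<tau> i" using that \<tau>l[of i] \<tau>j[of i] by (cases "i < j") auto
    moreover have "A1 $$ (i, l) = herm_entry A (\<tau> i) l"
      using that len swap[of i l] by (simp add: A1_def herm_swap_def \<tau>l)
    ultimately have "A1 $$ (i, l) = A $$ (\<tau> i, l)" by (simp add: herm_entry_def)
    also have "\<dots> = residual P (take l os) (os ! \<tau> i) (os ! l) / complex_of_real (sqrt (Re (pivot P os l)))"
      using inv jk that \<open>l < \<tau> i\<close> \<tau>n by (simp add: chol_inv_def)
    finally show ?thesis
      using that os'_nth[of i] os'_nth[of l] by (simp add: R_def take pivot_old \<tau>l)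
  qed
  have A1_diag: "A1 $$ (l, l) = complex_of_real (sqrt (Re (pivot P os' l)))" if "l < j" for l
    using that len jn swap[of l l] inv
    by (simp add: A1_def herm_swap_def \<tau>l herm_entry_def pivot_old chol_inv_def)
  have A1_trail: "A1 $$ (i, l) = P (os' ! i) (os' ! l)"
    if "j \<le> l" "l \<le> i" "i < n" "(i, l) \<noteq> (j, j)" for i l
  proof -
    have A_old: "A $$ (a, b) = P (os ! a) (os ! b)" if "j \<le> b" "b \<le> a" "a < n" for a b
      using that inv jk by (simp add: chol_inv_def)
    have ab: "j \<le> \<tau> i" "j \<le> \<tau> l" "\<tau> i < n" "\<tau> l < n" using that \<tau>j \<tau>n by auto
    have "A1 $$ (i, l) = herm_entry A (\<tau> i) (\<tau> l)"
      using that len swap[of i l] by (simp add: A1_def herm_swap_def)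
    also have "\<dots> = P (os ! \<tau> i) (os ! \<tau> l)"
    proof (cases "\<tau> l \<le> \<tau> i")
      case True
      then show ?thesis using ab by (simp add: herm_entry_def A_old)
    next
      case False
      have "os ! \<tau> i < n" "os ! \<tau> l < n" using os'_less[of i] os'_less[of l] os'_nth that by auto
      then have "P (os ! \<tau> i) (os ! \<tau> l) = cnj (P (os ! \<tau> l) (os ! \<tau> i))"
        by (intro hprojD(1)[OF P])
      then show ?thesis using False ab by (simp add: herm_entry_def A_old)
    qed
    finally show ?thesis using that os'_nth by simp
  qed
  have take_Suc: "take (Suc j) os' = take j os @ [os ! t]"
    using os'_perm jn x by (simp add: take_Suc_conv_app_nth take x_def)
  have step_eq: "pivot_step n k j (A, d, os) t = bind_prog (sqrt_prog (d' ! j)) (\<lambda>r.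
      if j = k - 1 then ret (herm_swap j t A |\<^sub>m (j, j) \<mapsto> complex_of_real r, d', os')
      else bind_prog (update_column n j (herm_swap j t A |\<^sub>m (j, j) \<mapsto> complex_of_real r)) (\<lambda>A.
        bind_prog (scale_column n j (A, d')) (\<lambda>(A, d). ret (A, d, os'))))"
    unfolding os'_def d'_def pivot_step_def Let_def prod.case ..
  let ?Q = "\<lambda>(A', d', os'). chol_inv n k P (Suc j) (A', d', os') \<and> take (Suc j) os' = take j os @ [os ! t]"
  show ?thesis
  proof (cases "j = k - 1")
    case True
    then have "Suc j = k" using jk by simp
    have "chol_inv n k P (Suc j) (A1, d', os')"
      using A1 A1_jj A1_diag os'_perm piv len r(1) \<open>Suc j = k\<close> pivot_R[of j]
      by (auto simp: chol_inv_def d'_def swap_list_def less_Suc_eq x_def)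
    then have "ensures (pivot_step n k j (A, d, os) t) (1 + 0) ?Q"
      unfolding step_eq using True take_Suc r(3)
      by (intro ensures_bind[OF ensures_sqrt]) (auto intro!: ensures_ret simp: A1_def r_def)
    then show ?thesis by (rule ensures_weaken) auto
  next
    case False
    \<comment> \<open>\<open>A2\<close> is the matrix after the update of column \<open>j\<close>; \<open>A3\<close> and \<open>d3\<close> are the state after its scaling\<close>
    define A2 where "A2 = mat n n (\<lambda>(i, l). if l = j \<and> j < i
       then A1 $$ (i, j) - (\<Sum>m<j. A1 $$ (i, m) * cnj (A1 $$ (j, m))) else A1 $$ (i, l))"
    define A3 where "A3 = mat n n (\<lambda>(i, l). if l = j \<and> j < i then A2 $$ (i, j) / A2 $$ (j, j) else A2 $$ (i, l))"
    define d3 where "d3 = map (\<lambda>i. if j < i then d' ! i - (cmod (A2 $$ (i, j) / A2 $$ (j, j)))\<^sup>2 else d' ! i) [0..<n]"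
    have A2_jj: "A2 $$ (j, j) = complex_of_real r" using jn A1_jj by (simp add: A2_def)
    have A2_col: "A2 $$ (i, j) = R j (os' ! i) x" if "j < i" "i < n" for i
    proof -
      have "A1 $$ (i, m) * cnj (A1 $$ (j, m)) = R m (os' ! i) (os' ! m) * R m (os' ! m) x / pivot P os' m"
        if "m < j" for m
      proof -
        have "cnj (R m x (os' ! m)) = R m (os' ! m) x"
          using that jn by (intro hprojD(1)[OF R, symmetric]) (auto intro: os'_less x(1))
        moreover have "complex_of_real (sqrt (Re (pivot P os' m))) * complex_of_real (sqrt (Re (pivot P os' m)))
            = pivot P os' m"
          using piv[of m] that by (simp flip: of_real_mult)
        ultimately show ?thesis
          using that \<open>j < i\<close> \<open>i < n\<close> jn by (simp add: A1_done x_def)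
      qed
      then have "A2 $$ (i, j) = P (os' ! i) x - (\<Sum>m<j. R m (os' ! i) (os' ! m) * R m (os' ! m) x / pivot P os' m)"
        using that jn A1_trail[of j i] by (simp add: A2_def x_def)
      also have "\<dots> = R j (os' ! i) x"
        using os'_perm jn by (simp add: R_def residual_expand[of j])
      finally show ?thesis .
    qed
    have A3_lower: "A3 $$ (i, l) = R l (os' ! i) (os' ! l) / complex_of_real (sqrt (Re (pivot P os' l)))"
      if "l < Suc j" "l < i" "i < n" for i l
      using that A1_done[of l i] A2_col[of i] jn A2_jj pivot_R[of j]
      by (auto simp: A3_def A2_def less_Suc_eq x_def r(1))
    have A3_diag: "A3 $$ (l, l) = complex_of_real (sqrt (Re (pivot P os' l)))" if "l < Suc j" for l
      using that jn A1_diag[of l] A2_jj pivot_R[of j] by (auto simp: A3_def A2_def less_Suc_eq x_def r(1))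
    have A3_trail: "A3 $$ (i, l) = P (os' ! i) (os' ! l)" if "Suc j \<le> l" "l \<le> i" "i < n" for i l
      using that A1_trail[of l i] by (auto simp: A3_def A2_def)
    have d3_R: "d3 ! i = Re (residual P (take (Suc j) os') (os' ! i) (os' ! i))" if "Suc j \<le> i" "i < n" for i
    proof -
      have "residual P (take (Suc j) os') = schur (R j) x"
        using os'_perm jn by (simp add: residual_take_Suc R_def x_def)
      moreover have "d3 ! i = d' ! i - (cmod (A2 $$ (i, j) / A2 $$ (j, j)))\<^sup>2"
        using that by (simp add: d3_def)
      ultimately show ?thesis
        using that d'_R[of i] A2_jj A2_col[of i] os'_less[of i]
          schur_diag[OF R[OF order_refl] _ x(1) nz, of "os' ! i"] r(1)
        by simp
    qed
    have "chol_inv n k P (Suc j) (A3, d3, os')"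
      using os'_perm piv A3_lower A3_diag A3_trail d3_R
      by (auto simp: chol_inv_def A3_def d3_def R_def less_Suc_eq_le)
    then have post: "?Q (A3, d3, os')"
      using take_Suc by simp
    have "ensures (bind_prog (update_column n j A1)
          (\<lambda>A. bind_prog (scale_column n j (A, d')) (\<lambda>(A, d). ret (A, d, os'))))
        ((n - (j + 1)) * (j * 3) + ((n - (j + 1)) * 3 + 0)) ?Q"
    proof (rule ensures_bind[OF ensures_update_column[OF A1 jn]])
      fix B assume "B = mat n n (\<lambda>(i, l). if l = j \<and> j < i
       then A1 $$ (i, j) - (\<Sum>m<j. A1 $$ (i, m) * cnj (A1 $$ (j, m))) else A1 $$ (i, l))"
      then have B: "B = A2" by (simp add: A2_def)
      have "A2 \<in> carrier_mat n n" "length d' = n" "A2 $$ (j, j) \<noteq> 0"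
        using A2_jj r(2) len by (auto simp: A2_def d'_def swap_list_def)
      note scale = ensures_scale_column[OF this(1) jn this(2,3), folded A3_def d3_def]
      show "ensures (bind_prog (scale_column n j (B, d')) (\<lambda>(A, d). ret (A, d, os'))) ((n - (j + 1)) * 3 + 0) ?Q"
        unfolding B using post by (intro ensures_bind[OF scale]) (auto intro!: ensures_ret)
    qed
    then have "ensures (pivot_step n k j (A, d, os) t)
        (1 + ((n - (j + 1)) * (j * 3) + ((n - (j + 1)) * 3 + 0))) ?Q"
      unfolding step_eq using False
      by (intro ensures_bind[OF ensures_sqrt[OF r(3)]]) (simp add: A1_def r_def)
    moreover have "(n - (j + 1)) * (j * 3) + (n - (j + 1)) * 3 = (n - (j + 1)) * ((j + 1) * 3)"
      by (simp add: algebra_simps)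
    moreover have "\<dots> \<le> n * (k * 3)" using jk by (intro mult_le_mono) auto
    ultimately show ?thesis by (elim ensures_weaken) auto
  qed
qed

section \<open>The law of the sampled set\<close>

text \<open>
  The principal minor of \<open>P\<close> with the index set \<open>Z\<close>.
\<close>

definition minor_set :: "(nat \<Rightarrow> nat \<Rightarrow> complex) \<Rightarrow> nat set \<Rightarrow> complex" where
  "minor_set P Z = minor P (sorted_list_of_set Z)"

lemma minor_set_eq: "distinct xs \<Longrightarrow> minor_set P (set xs) = minor P xs"
  unfolding minor_set_def by (rule minor_permute) (simp add: set_eq_iff_mset_eq_distinct[symmetric])

lemma minor_set_pivot:
  assumes "finite Z" "x \<in> Z" "P x x \<noteq> 0"
  shows "P x x * minor_set (schur P x) (Z - {x}) = minor_set P Z"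
proof -
  let ?xs = "sorted_list_of_set (Z - {x})"
  have "minor_set P Z = minor_set P (set (x # ?xs))"
    using assms by (simp add: insert_absorb)
  also have "\<dots> = minor P (x # ?xs)"
    using assms by (intro minor_set_eq) simp
  finally show ?thesis using assms(3) by (simp add: minor_Cons minor_set_def)
qed

lemma minor_set_zero_row:
  assumes "hproj n P" "Z \<subseteq> {0..<n}" "x \<in> Z" "P x x = 0"
  shows "minor_set P Z = 0"
proof -
  have "finite Z" using assms(2) finite_subset by blast
  then show ?thesis
    unfolding minor_set_def using assms
    by (intro minor_zero_row[of x]) (auto intro!: hproj_zero_row[OF assms(1)])
qed

text \<open>
  One step from a state that satisfies the invariant, for a projection of trace \<open>k\<close>. The drawing
  weights sum to one because the residual after \<open>j\<close> pivots has trace \<open>k - j\<close>.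
\<close>

context
  fixes n k j :: nat and P :: "nat \<Rightarrow> nat \<Rightarrow> complex" and A d os
  assumes P: "hproj n P" and trace: "(\<Sum>a<n. P a a) = of_nat k"
    and inv: "chol_inv n k P j (A, d, os)" and jk: "j < k" and kn: "k \<le> n"
begin

lemma os_perm: "distinct os" "set os = {0..<n}" "length os = n"
  using inv chol_inv_length[OF inv] by (auto simp: chol_inv_def)

lemma hproj_residual: "hproj n (residual P (take j os))"
  using chol_inv_residual(1)[OF P inv order_refl] jk kn by simp

lemma diag_eq:
  assumes "j \<le> t" "t < n"
  shows "d ! t = Re (residual P (take j os) (os ! t) (os ! t))" "0 \<le> d ! t"
proof -
  show e: "d ! t = Re (residual P (take j os) (os ! t) (os ! t))"
    using inv jk assms by (simp add: chol_inv_def)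
  have "os ! t < n" using os_perm assms nth_mem[of t os] by auto
  then show "0 \<le> d ! t" unfolding e by (intro hproj_diag_Re(2)[OF hproj_residual])
qed

lemma sum_remaining: "(\<Sum>t\<in>{j..<n}. f (os ! t)) = (\<Sum>x\<in>{0..<n} - set (take j os). f x)"
proof -
  have inj: "inj_on ((!) os) {0..<n}" using os_perm by (auto intro: inj_on_nth)
  have "(!) os ` ({0..<n} - {0..<j}) = (!) os ` {0..<n} - (!) os ` {0..<j}"
    using inj jk kn by (intro inj_on_image_set_diff) auto
  moreover have "{0..<n} - {0..<j} = {j..<n}" by auto
  ultimately have "(!) os ` {j..<n} = {0..<n} - set (take j os)"
    using os_perm jk kn by (simp add: nth_image)
  moreover have "inj_on ((!) os) {j..<n}" by (rule inj_on_subset[OF inj]) auto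
  ultimately show ?thesis by (metis (no_types, lifting) sum.reindex_cong)
qed

lemma weights_wf: "pmf_of_list_wf (weights n k j d)"
proof (rule pmf_of_list_wfI)
  fix x assume "x \<in> set (map snd (weights n k j d))"
  then show "0 \<le> x" using diag_eq(2) by (auto simp: weights_def)
next
  let ?R = "residual P (take j os)"
  have "(\<Sum>t\<in>{j..<n}. d ! t) = (\<Sum>t\<in>{j..<n}. Re (?R (os ! t) (os ! t)))"
    using diag_eq(1) by (intro sum.cong) auto
  also have "\<dots> = (\<Sum>x\<in>{0..<n} - set (take j os). Re (?R x x))"
    by (rule sum_remaining)
  also have "\<dots> = (\<Sum>x\<in>{0..<n}. Re (?R x x))"
    using chol_inv_residual(3)[OF P inv order_refl] jk kn by (intro sum.mono_neutral_left) auto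
  also have "\<dots> = Re (\<Sum>x<n. ?R x x)" by (simp add: lessThan_atLeast0)
  also have "\<dots> = real (k - j)"
    using chol_inv_residual(2)[OF P inv order_refl] jk kn by (simp add: trace of_nat_diff)
  finally show "sum_list (map snd (weights n k j d)) = 1"
    using jk by (simp add: weights_def o_def interv_sum_list_conv_sum_set_nat flip: sum_divide_distrib)
qed

lemma pmf_weights:
  "pmf (pmf_of_list (weights n k j d)) t = (if j \<le> t \<and> t < n then d ! t / real (k - j) else 0)"
proof -
  have "filter (\<lambda>z. fst z = t) (weights n k j d) =
      map (\<lambda>t. (t, d ! t / real (k - j))) (filter (\<lambda>i. i = t) [j..<n])"
    by (simp add: weights_def filter_map o_def)
  moreover have "filter (\<lambda>i. i = t) [j..<n] = (if j \<le> t \<and> t < n then [t] else [])"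
    by (induction n) auto
  ultimately show ?thesis by (simp add: pmf_pmf_of_list[OF weights_wf])
qed

lemma drawn_index:
  assumes "t \<in> set_pmf (pmf_of_list (weights n k j d))"
  shows "j \<le> t" "t < n" "d ! t \<noteq> 0"
  using assms by (auto simp: set_pmf_iff pmf_weights split: if_splits)

lemma ensures_chol_step:
  "ensures (chol_step n k j (A, d, os)) (6 * n * k) (chol_inv n k P (Suc j))"
proof -
  have "ensures (chol_step n k j (A, d, os)) (2 * length (weights n k j d) + (1 + 3 * n * k))
      (chol_inv n k P (Suc j))"
    unfolding chol_step_eq
  proof (rule ensures_bind[OF ensures_draw[OF weights_wf]])
    fix t assume "t \<in> set_pmf (pmf_of_list (weights n k j d))"
    note t = drawn_index[OF this]
    show "ensures (pivot_step n k j (A, d, os) t) (1 + 3 * n * k) (chol_inv n k P (Suc j))"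
      by (rule ensures_weaken[OF ensures_pivot_step[OF P inv jk t]]) auto
  qed
  moreover have "2 * length (weights n k j d) + (1 + 3 * n * k) \<le> 6 * n * k"
  proof -
    have "2 * length (weights n k j d) + 1 \<le> 3 * n" using jk kn by (simp add: weights_def)
    also have "\<dots> \<le> 3 * n * k" using jk by simp
    finally show ?thesis by linarith
  qed
  ultimately show ?thesis by (rule ensures_weaken)
qed

end

text \<open>
  The law of the final set of pivots, given the state before step \<open>j\<close>. In the induction step, with
  \<open>R\<close> the residual and \<open>Z\<close> the set of the \<open>k - j\<close> indices of \<open>Y\<close> still to be drawn, every \<open>x \<in> Z\<close>
  contributes \<open>R x x / (k - j)\<close> times the minor of \<open>Z - {x}\<close> in the Schur complement at \<open>x\<close>, which is
  \<open>1 / (k - j)\<close> times the minor of \<open>Z\<close> in \<open>R\<close> independently of \<open>x\<close>.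
\<close>

lemma spmf_pivot_set:
  assumes P: "hproj n P" and trace: "(\<Sum>a<n. P a a) = of_nat k" and kn: "k \<le> n"
    and inv: "chol_inv n k P j (A, d, os)" and "j \<le> k"
  shows "spmf (map_spmf (\<lambda>(A, d, os). set (take k os))
      (outcome (for_each [j..<k] (chol_step n k) (A, d, os)))) Y
    = (if Y \<subseteq> {0..<n} \<and> set (take j os) \<subseteq> Y \<and> card Y = k
       then Re (minor_set (residual P (take j os)) (Y - set (take j os))) else 0)"
  using inv \<open>j \<le> k\<close>
proof (induction "k - j" arbitrary: j A d os)
  case 0
  then have "j = k" by simp
  have os: "distinct os" "set os = {0..<n}" "length os = n"
    using 0 chol_inv_length[of n k P j A d os] by (auto simp: chol_inv_def)
  have "card (set (take k os)) = k"
    using distinct_card[OF distinct_take[OF os(1), of k]] os(3) kn by simp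
  moreover have "set (take k os) \<subseteq> {0..<n}"
    using os set_take_subset[of k os] by auto
  moreover have "Y = set (take k os)" if "set (take k os) \<subseteq> Y" "card Y = k" "Y \<subseteq> {0..<n}"
    using that card_subset_eq[of Y "set (take k os)"] \<open>card (set (take k os)) = k\<close>
      finite_subset[of Y "{0..<n}"] by auto
  ultimately show ?case
    using \<open>j = k\<close> by (auto simp: outcome_ret minor_set_def minor_def split: split_indicator)
next
  case (Suc m)
  then have jk: "j < k" by simp
  note inv = Suc.prems(1)
  note perm = os_perm[OF P trace inv jk kn]
  define S where "S = set (take j os)"
  define R where "R = residual P (take j os)"
  define D where "D = pmf_of_list (weights n k j d)"
  define F where "F t = map_spmf (\<lambda>(A, d, os). set (take k os))
     (outcome (bind_prog (pivot_step n k j (A, d, os) t) (for_each [Suc j..<k] (chol_step n k))))" for t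
  define good where "good \<longleftrightarrow> Y \<subseteq> {0..<n} \<and> S \<subseteq> Y \<and> card Y = k"
  have hR: "hproj n R" unfolding R_def by (rule hproj_residual[OF P trace inv jk kn])
  have Sn: "S \<subseteq> {0..<n}" using perm set_take_subset[of j os] by (auto simp: S_def)
  have F: "spmf (F t) Y = (if good \<and> os ! t \<in> Y
      then Re (minor_set (schur R (os ! t)) (Y - S - {os ! t})) else 0)"
    if t: "t \<in> set_pmf D" for t
    unfolding F_def
  proof (rule spmf_outcome_bind_const[OF ensures_pivot_step])
    show "hproj n P" "chol_inv n k P j (A, d, os)" "j < k" "j \<le> t" "t < n" "d ! t \<noteq> 0"
      using P inv jk drawn_index[OF P trace inv jk kn] t by (auto simp: D_def)
    fix s :: chol_state
    obtain A' d' os' where s: "s = (A', d', os')" by (cases s)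
    assume "case s of (A', d', os') \<Rightarrow>
      chol_inv n k P (Suc j) (A', d', os') \<and> take (Suc j) os' = take j os @ [os ! t]"
    then have s': "chol_inv n k P (Suc j) (A', d', os')" "take (Suc j) os' = take j os @ [os ! t]"
      by (auto simp: s)
    have "Y - insert (os ! t) S = Y - S - {os ! t}" by auto
    then show "spmf (map_spmf (\<lambda>(A, d, os). set (take k os))
        (outcome (for_each [Suc j..<k] (chol_step n k) s))) Y
      = (if good \<and> os ! t \<in> Y then Re (minor_set (schur R (os ! t)) (Y - S - {os ! t})) else 0)"
      unfolding s using Suc.hyps(1)[OF _ s'(1)] Suc.hyps(2) jk
      by (auto simp: s'(2) residual_snoc good_def S_def R_def)
  qed
  have finD: "set_pmf D \<subseteq> {j..<n}"
    using drawn_index[OF P trace inv jk kn] by (auto simp: D_def)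
  have "outcome (for_each [j..<k] (chol_step n k) (A, d, os)) = bind_spmf (spmf_of_pmf D)
      (\<lambda>t. outcome (bind_prog (pivot_step n k j (A, d, os) t) (for_each [Suc j..<k] (chol_step n k))))"
    using jk by (simp add: upt_conv_Cons chol_step_eq outcome_bind D_def
        outcome_draw[OF weights_wf[OF P trace inv jk kn]] del: bind_spmf_of_pmf)
  then have "map_spmf (\<lambda>(A, d, os). set (take k os)) (outcome (for_each [j..<k] (chol_step n k) (A, d, os)))
      = bind_pmf D F"
    by (simp add: map_spmf_bind_spmf F_def[abs_def] o_def del: bind_spmf_of_pmf) simp
  then have "spmf (map_spmf (\<lambda>(A, d, os). set (take k os))
        (outcome (for_each [j..<k] (chol_step n k) (A, d, os)))) Y
      = (\<Sum>t\<in>{j..<n}. spmf (F t) Y * pmf D t)"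
    using finD by (simp add: pmf_bind integral_measure_pmf_real[of "{j..<n}"] subset_iff)
  also have "\<dots> = (\<Sum>t\<in>{j..<n}. if good \<and> os ! t \<in> Y then Re (minor_set R (Y - S)) / real (k - j) else 0)"
  proof (rule sum.cong[OF refl])
    fix t assume t: "t \<in> {j..<n}"
    define x where "x = os ! t"
    have dt: "pmf D t = Re (R x x) / real (k - j)"
      using t pmf_weights[OF P trace inv jk kn, of t] diag_eq(1)[OF P trace inv jk kn, of t]
      by (simp add: D_def R_def x_def)
    have "x < n" using t perm nth_mem[of t os] by (auto simp: x_def)
    have "x \<notin> S"
      using t perm by (auto simp: S_def x_def in_set_conv_nth nth_eq_iff_index_eq)
    show "spmf (F t) Y * pmf D t = (if good \<and> os ! t \<in> Y then Re (minor_set R (Y - S)) / real (k - j) else 0)"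
    proof (cases "R x x = 0")
      \<comment> \<open>such an \<open>x\<close> is never drawn, and its zero row makes the claimed share vanish as well\<close>
      case True
      then have "minor_set R (Y - S) = 0" if "good" "x \<in> Y"
        using that \<open>x \<notin> S\<close> by (intro minor_set_zero_row[OF hR, of _ x]) (auto simp: good_def)
      then show ?thesis using True dt by (auto simp: x_def)
    next
      case False
      have real: "R x x = complex_of_real (Re (R x x))" by (rule hproj_diag_Re(1)[OF hR \<open>x < n\<close>])
      then have "Re (R x x) \<noteq> 0" using False by (metis of_real_0)
      then have "t \<in> set_pmf D" using dt jk by (simp add: set_pmf_iff)
      moreover have "Re (minor_set (schur R x) (Y - S - {x})) * Re (R x x) = Re (minor_set R (Y - S))"
        if "good" "x \<in> Y"
      proof -
        have "finite (Y - S)" using that finite_subset[of Y "{0..<n}"] by (auto simp: good_def)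
        then have "R x x * minor_set (schur R x) (Y - S - {x}) = minor_set R (Y - S)"
          using that \<open>x \<notin> S\<close> False by (intro minor_set_pivot) auto
        then have "Re (complex_of_real (Re (R x x)) * minor_set (schur R x) (Y - S - {x})) = Re (minor_set R (Y - S))"
          by (simp flip: real)
        then show ?thesis by (simp add: mult.commute)
      qed
      ultimately show ?thesis using dt by (auto simp: F x_def)
    qed
  qed
  also have "\<dots> = (\<Sum>x\<in>{0..<n} - S. if good \<and> x \<in> Y then Re (minor_set R (Y - S)) / real (k - j) else 0)"
    unfolding S_def by (rule sum_remaining[OF P trace inv jk kn])
  also have "\<dots> = (if good then Re (minor_set R (Y - S)) else 0)"
  proof (cases good)
    case True
    then have "finite Y" and Y: "Y \<subseteq> {0..<n}" "S \<subseteq> Y" "card Y = k"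
      using finite_subset[of Y "{0..<n}"] by (auto simp: good_def)
    have "card S = j"
      using distinct_card[OF distinct_take[OF perm(1), of j]] perm(3) jk kn by (simp add: S_def)
    then have card: "card (Y - S) = k - j"
      using Y card_Diff_subset[of S Y] finite_subset[OF Y(2) \<open>finite Y\<close>] by simp
    have "{x \<in> {0..<n} - S. x \<in> Y} = Y - S" using Y by auto
    then show ?thesis
      using True jk card by (simp add: sum.If_cases Int_def)
  qed simp
  finally show ?case by (simp add: good_def S_def R_def)
qed

section \<open>Determinantal point processes of projections\<close>

lemma ensures_cholesky_factorization:
  assumes P: "hproj n P" and trace: "(\<Sum>a<n. P a a) = of_nat k" and kn: "k \<le> n"
    and inv: "chol_inv n k P 0 s"
  shows "ensures (for_each [0..<k] (chol_step n k) s) (k * (6 * n * k)) (chol_inv n k P k)"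
proof -
  have "ensures (for_each [0..<k] (chol_step n k) s) ((k - 0) * (6 * n * k)) (chol_inv n k P k)"
  proof (rule ensures_for_each[where I = "chol_inv n k P"])
    fix j and s :: chol_state assume "0 \<le> j" "j < k" "chol_inv n k P j s"
    moreover obtain A d os where "s = (A, d, os)" by (cases s)
    ultimately show "ensures (chol_step n k j s) (6 * n * k) (chol_inv n k P (Suc j))"
      using ensures_chol_step[OF P trace _ _ kn] by blast
  qed (use inv in auto)
  then show ?thesis by simp
qed

text \<open>
  Two distributions with a common finite support set coincide if one lies pointwise below the other,
  as both have total mass one.
\<close>

lemma pmf_eqI_le:
  assumes "finite A" "set_pmf p \<subseteq> A" "set_pmf q \<subseteq> A" "\<And>x. x \<in> A \<Longrightarrow> pmf q x \<le> pmf p x"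
  shows "p = q"
proof (rule pmf_eqI)
  fix x
  have "(\<Sum>x\<in>A. pmf p x - pmf q x) = 0"
    using sum_pmf_eq_1[OF assms(1,2)] sum_pmf_eq_1[OF assms(1,3)] by (simp add: sum_subtractf)
  then have "pmf p x - pmf q x = 0" if "x \<in> A"
    using that assms(1,4) by (subst (asm) sum_nonneg_eq_0_iff) auto
  then show "pmf p x = pmf q x"
    using assms(2,3) by (cases "x \<in> A") (auto simp: set_pmf_iff dest!: subsetD[of _ A x])
qed

text \<open>
  A sample has at most \<open>k\<close> elements, because a principal minor larger than the rank vanishes. So
  the only sample that contains a set \<open>Y\<close> with \<open>k\<close> elements is \<open>Y\<close> itself.
\<close>

lemma DPP_pmf:
  assumes K: "K \<in> carrier_mat n n" and dpp: "is_DPP n K p" and rank: "vec_space.rank n K = k"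
    and Y: "Y \<subseteq> {0..<n}" "card Y = k"
  shows "complex_of_real (pmf p Y) = det (submatrix K Y Y)"
proof -
  have prob: "complex_of_real (measure_pmf.prob p {S. Z \<subseteq> S}) = det (submatrix K Z Z)"
    if "Z \<subseteq> {0..<n}" for Z
    using dpp that by (simp add: is_DPP_def)
  have card_le: "card S \<le> k" if "S \<in> set_pmf p" for S
  proof -
    have S: "S \<subseteq> {0..<n}" using dpp that by (auto simp: is_DPP_def)
    have "0 < pmf p S" using that by (simp add: pmf_positive_iff)
    also have "\<dots> \<le> measure_pmf.prob p {T. S \<subseteq> T}"
      unfolding measure_pmf_single[symmetric] by (intro measure_pmf.finite_measure_mono) auto
    finally have "det (submatrix K S S) \<noteq> 0" using prob[OF S] by (metis less_irrefl of_real_eq_0_iff)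
    then have "card {i. i < n \<and> i \<in> S} \<le> k"
      using vec_space.rank_gt_minor[OF K] rank by blast
    moreover have "{i. i < n \<and> i \<in> S} = S" using S by auto
    ultimately show ?thesis by simp
  qed
  have "S = Y" if "S \<in> set_pmf p" "Y \<subseteq> S" for S
  proof -
    have "finite S" using dpp that finite_subset[of S "{0..<n}"] by (auto simp: is_DPP_def)
    then show ?thesis using card_seteq[OF _ that(2)] card_le[OF that(1)] Y(2) by auto
  qed
  then have "{S. Y \<subseteq> S} \<inter> set_pmf p = {Y} \<inter> set_pmf p" by auto
  then have "measure_pmf.prob p {S. Y \<subseteq> S} = measure_pmf.prob p {Y}"
    using measure_Int_set_pmf by metis
  then show ?thesis using prob[OF Y(1)] by (simp add: measure_pmf_single)
qed

lemma hproj_of_mat: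
  assumes "K \<in> carrier_mat n n" "mat_adjoint K = K" "K * K = K"
  shows "hproj n (\<lambda>a b. K $$ (a, b))"
  unfolding hproj_def
proof (intro conjI allI impI)
  fix a b assume ab: "a < n" "b < n"
  have "mat_adjoint K $$ (b, a) = cnj (K $$ (a, b))"
    using ab assms(1) by (simp add: mat_adjoint_def mat_of_rows_def)
  then show "K $$ (b, a) = cnj (K $$ (a, b))" using assms(2) by simp
  have "(K * K) $$ (a, b) = (\<Sum>c<n. K $$ (a, c) * K $$ (c, b))"
    using ab assms(1) by (simp add: scalar_prod_def lessThan_atLeast0)
  then show "(\<Sum>c<n. K $$ (a, c) * K $$ (c, b)) = K $$ (a, b)" using assms(3) by simp
qed

lemma chol_inv_initial:
  assumes "K \<in> carrier_mat n n"
  shows "chol_inv n k (\<lambda>a b. K $$ (a, b)) 0 (K, map Re (diag_mat K), [0..<n])"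
  using assms by (auto simp: chol_inv_def diag_mat_def)

lemma pick_atLeastLessThan: "j < k \<Longrightarrow> pick {0..<k} j = j"
proof (induction j rule: less_induct)
  case (less j)
  then have j: "j < card {0..<k}" by simp
  note pick_in_set_le[OF j] card_pick_le[OF j]
  moreover have "{a \<in> {0..<k}. a < b} = {0..<b}" if "b < k" for b using that by auto
  ultimately show ?case by simp
qed

theorem theorem3:
  shows "\<exists>C::real. \<forall>(n::nat) (k::nat) (K::complex mat).
    K \<in> carrier_mat n n \<longrightarrow> marginal_kernel n K \<longrightarrow>
    mat_adjoint K = K \<longrightarrow> K * K = K \<longrightarrow> vec_space.rank n K = k \<longrightarrow>
    (let R = run (cholesky_sampler n k K) in
       lossless_spmf R \<and>
       (\<exists>p. is_DPP n K p \<and>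
            map_spmf (\<lambda>((Y, A), c). Y) R = spmf_of_pmf p \<and>
            (\<forall>((Y, A), c) \<in> set_spmf R.
               card Y = k \<and>
               complex_of_real (pmf p Y) = (\<Prod>j<k. A $$ (j, j))\<^sup>2 \<and>
               real c \<le> C * (real n * (real k)\<^sup>2))))"
proof (intro exI[of _ 6] allI impI)
  fix n k :: nat and K :: "complex mat"
  assume K: "K \<in> carrier_mat n n" and "marginal_kernel n K" and adj: "mat_adjoint K = K"
    and idem: "K * K = K" and rank: "vec_space.rank n K = k"
  obtain p where p: "is_DPP n K p"
    using \<open>marginal_kernel n K\<close> by (auto simp: marginal_kernel_def)
  define P where "P = (\<lambda>a b. K $$ (a, b))"
  have P: "hproj n P" unfolding P_def by (rule hproj_of_mat[OF K adj idem])
  have "mat n n (\<lambda>(a, b). P a b) = K" using K by (auto simp: P_def)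
  then have "(\<Sum>a<n. Re (P a a)) = real k"
    using hproj_rank_eq_trace[OF P] rank by simp
  moreover have "(\<Sum>a<n. P a a) = (\<Sum>a<n. complex_of_real (Re (P a a)))"
    using hproj_diag_Re(1)[OF P] by (intro sum.cong refl) blast
  ultimately have trace: "(\<Sum>a<n. P a a) = of_nat k"
    by (simp flip: of_real_sum)
  have kn: "k \<le> n" using vec_space.rank_le_nc[OF K] rank by simp
  define s where "s = (K, map Re (diag_mat K), [0..<n])"
  have inv: "chol_inv n k P 0 s" unfolding s_def P_def by (rule chol_inv_initial[OF K])
  have prob: "complex_of_real (pmf p Y) = minor_set P Y" if "Y \<subseteq> {0..<n}" "card Y = k" for Y
    using DPP_pmf[OF K p rank that] det_submatrix_eq_minor[OF K, of "sorted_list_of_set Y"]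
      that finite_subset[OF that(1)]
    by (simp add: P_def minor_set_def)
  define R where "R = run (cholesky_sampler n k K)"
  define Q where "Q = (\<lambda>(Y, A :: complex mat). card Y = k \<and> complex_of_real (pmf p Y) = (\<Prod>j<k. A $$ (j, j))\<^sup>2)"
  have sampler: "cholesky_sampler n k K = bind_prog (for_each [0..<k] (chol_step n k) s)
     (\<lambda>(A, d, os). ret (set (take k os), submatrix A {0..<k} {0..<k}))"
    by (simp add: cholesky_sampler_def s_def)
  have final: "Q (set (take k os), submatrix A {0..<k} {0..<k})" if inv: "chol_inv n k P k (A, d, os)" for A d os
  proof -
    have os: "distinct os" "set os = {0..<n}" "length os = n" and A: "A \<in> carrier_mat n n"
      using inv chol_inv_length[OF inv] by (auto simp: chol_inv_def)
    have card: "card (set (take k os)) = k"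
      using distinct_card[OF distinct_take[OF os(1), of k]] os(3) kn by simp
    have diag: "(submatrix A {0..<k} {0..<k} $$ (j, j))\<^sup>2 = pivot P os j" if "j < k" for j
    proof -
      have "{i. i < n \<and> i < k} = {0..<k}" using kn by auto
      then have "submatrix A {0..<k} {0..<k} $$ (j, j) = A $$ (j, j)"
        using that A by (simp add: submatrix_index pick_atLeastLessThan)
      also have "\<dots> = complex_of_real (sqrt (Re (pivot P os j)))"
        using inv that by (simp add: chol_inv_def)
      finally have "submatrix A {0..<k} {0..<k} $$ (j, j) = complex_of_real (sqrt (Re (pivot P os j)))" .
      moreover have "os ! j < n" using that os kn nth_mem[of j os] by auto
      note hproj_diag_Re[OF chol_inv_residual(1)[OF P inv _ kn, of j] this]
      ultimately show ?thesis using that by (simp add: pivot_def flip: of_real_power)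
    qed
    have "set (take k os) \<subseteq> {0..<n}" using os set_take_subset[of k os] by auto
    then have "complex_of_real (pmf p (set (take k os))) = minor_set P (set (take k os))"
      using card by (rule prob)
    also have "\<dots> = minor P (take k os)" using os by (simp add: minor_set_eq)
    also have "\<dots> = (\<Prod>j<k. pivot P (take k os) j)"
      using inv os kn by (subst minor_eq_prod_pivots) (auto simp: pivot_take chol_inv_def)
    also have "\<dots> = (\<Prod>j<k. submatrix A {0..<k} {0..<k} $$ (j, j))\<^sup>2"
      using os kn by (simp add: pivot_take diag prod_power_distrib)
    finally show ?thesis using card by (simp add: Q_def)
  qed
  have "ensures (cholesky_sampler n k K) (k * (6 * n * k) + 0) Q"
    unfolding sampler
    by (rule ensures_bind[OF ensures_cholesky_factorization[OF P trace kn inv]])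
      (auto intro!: ensures_ret final)
  then have lossless: "lossless_spmf R" and bound: "\<And>x c. (x, c) \<in> set_spmf R \<Longrightarrow> c \<le> k * (6 * n * k) \<and> Q x"
    by (auto simp: ensures_def R_def)
  obtain q where q: "map_spmf (\<lambda>((Y, A), c). Y) R = spmf_of_pmf q"
    using lossless lossless_iff_pmf_None lossless_spmf_conv_spmf_of_pmf[of "map_spmf (\<lambda>((Y, A), c). Y) R"] by auto
  have "spmf_of_pmf q = map_spmf fst (outcome (cholesky_sampler n k K))"
  proof -
    have "(\<lambda>((Y :: nat set, A :: complex mat), c :: nat). Y) = fst \<circ> fst" by (auto simp: fun_eq_iff)
    then show ?thesis by (simp add: outcome_def R_def spmf.map_comp flip: q)
  qed
  also have "\<dots> = map_spmf (\<lambda>(A, d, os). set (take k os)) (outcome (for_each [0..<k] (chol_step n k) s))"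
    unfolding sampler
    by (simp add: outcome_bind map_spmf_bind_spmf o_def outcome_ret case_prod_beta map_spmf_conv_bind_spmf)
  finally have q_eq: "spmf_of_pmf q = map_spmf (\<lambda>(A, d, os). set (take k os))
      (outcome (for_each [0..<k] (chol_step n k) s))" .
  have pmf_q: "pmf q Y = (if Y \<subseteq> {0..<n} \<and> card Y = k then Re (minor_set P Y) else 0)" for Y
    using spmf_pivot_set[OF P trace kn inv[unfolded s_def], of Y] arg_cong[OF q_eq, of "\<lambda>q. spmf q Y"]
    by (simp add: s_def)
  \<comment> \<open>nothing is known about \<open>p\<close> on sets with fewer than \<open>k\<close> elements, hence the comparison of masses\<close>
  have "p = q"
  proof (rule pmf_eqI_le)
    show "finite (Pow {0..<n})" by simp
    show "set_pmf p \<subseteq> Pow {0..<n}" using p by (simp add: is_DPP_def)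
    show "set_pmf q \<subseteq> Pow {0..<n}"
    proof
      fix Y assume "Y \<in> set_pmf q"
      then show "Y \<in> Pow {0..<n}" by (simp add: set_pmf_iff pmf_q split: if_splits)
    qed
    show "pmf q Y \<le> pmf p Y" for Y
      using prob[of Y] by (auto simp: pmf_q simp flip: prob)
  qed
  have "real c \<le> 6 * (real n * (real k)\<^sup>2)" if "c \<le> k * (6 * n * k)" for c
  proof -
    have "real c \<le> real (k * (6 * n * k))" using that by (rule of_nat_mono)
    then show ?thesis by (simp add: power2_eq_square algebra_simps)
  qed
  then show "let R = run (cholesky_sampler n k K) in
       lossless_spmf R \<and>
       (\<exists>p. is_DPP n K p \<and>
            map_spmf (\<lambda>((Y, A), c). Y) R = spmf_of_pmf p \<and>
            (\<forall>((Y, A), c) \<in> set_spmf R.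
               card Y = k \<and>
               complex_of_real (pmf p Y) = (\<Prod>j<k. A $$ (j, j))\<^sup>2 \<and>
               real c \<le> 6 * (real n * (real k)\<^sup>2)))"
    unfolding Let_def R_def[symmetric] using lossless p q \<open>p = q\<close> bound
    by (intro conjI exI[of _ p]) (fastforce simp: Q_def)+
qed

end
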